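(* Consider the contextual two-sided market with $n$ sellers and $n$ buyers: seller $i$ has unknown $\theta^s_i\in\mathbb B_d$, buyer $j$ unknown $\theta^b_j\in\mathbb B_d$, and in round $t$ an adversarial context $x_t\in\mathbb B_d$ is revealed, giving costs $c_{i,t}=\langle\theta^s_i,x_t\rangle$ and values $v_{j,t}=\langle\theta^b_j,x_t\rangle$ in $[0,1]$. Run the following algorithm (Ellipsoid Search in Two-Sided Markets) with $\delta=1/T$. Each trader has an ellipsoid, initially $\mathbb B_d$. In round $t$, for each seller let $\bar c_{i,t},\underline c_{i,t}$ be the max and min of $\langle\theta,x_t\rangle$ over the seller's ellipsoid, and similarly $\bar v_{j,t},\underline v_{j,t}$ for buyers. If some seller has $\bar c_{i,t}-\underline c_{i,t}>\delta$, pick one, post the single price $(\bar c_{i,t}+\underline c_{i,t})/2$ to all traders, and replace that seller's ellipsoid by the minimum-volume ellipsoid containing its intersection with the half-space consistent with that seller's feedback ($\{\theta:\langle\theta,x_t\rangle\le p\}$ if it accepted price $p$, $\{\theta:\langle\theta,x_t\rangle\ge p\}$ otherwise); else if some buyer has $\bar v_{j,t}-\underline v_{j,t}>\delta$, do the symmetric step for that buyer; otherwise keep all ellipsoids and post the segmented-price mechanism: compute a GFT-maximizing matching $M$ for costs $\bar c_{i,t}$ and values $\underline v_{j,t}$, with matched sets $S_1,B_1$; post $\max_{i\in S_1}\bar c_{i,t}$ to $S_1$, $0$ to other sellers, $\min_{j\in B_1}\underline v_{j,t}$ to $B_1$, and $1$ to other buyers. Then the cumulative gains-from-trade regret is $O(n^2d^2\log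 T)$.
   Context: $\mathbb B_d$ is the closed unit ball in $\mathbb R^d$. A seller accepts a price $p$ iff $p\ge$ its current cost; a buyer accepts price $q$ iff $q\le$ its current value (ties in favour of accepting). In each round a maximum-cardinality matching between accepting sellers and buyers is formed, with GFT $\sum_{(i,j)\in M}(v_{j,t}-c_{i,t})$. Round-$t$ benchmark $\mathrm{GFT}^\star_t$ is the maximum GFT over all matchings for the round-$t$ costs and values; round-$t$ regret is $\mathrm{GFT}^\star_t$ minus the minimum GFT over maximum-cardinality matchings of accepting traders; cumulative regret is the sum over $t=1,\dots,T$. *)

theory Defs
  imports "Jordan_Normal_Form.Determinant" "HOL-Analysis.Lebesgue_Measure"
begin

definition ip :: "real Matrix.vec \<Rightarrow> real Matrix.vec \<Rightarrow> real" where
  "ip x y = scalar_prod x y"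

definition unit_ball :: "nat \<Rightarrow> real Matrix.vec set" where
  "unit_ball d = {u \<in> carrier_vec d. ip u u \<le> 1}"

definition ellipsoid :: "nat \<Rightarrow> real mat \<Rightarrow> real Matrix.vec \<Rightarrow> real Matrix.vec set" where
  "ellipsoid d A c = {c + mult_mat_vec A u | u. u \<in> unit_ball d}"

definition is_ellipsoid :: "nat \<Rightarrow> real Matrix.vec set \<Rightarrow> bool" where
  "is_ellipsoid d E \<longleftrightarrow> (\<exists>A c. A \<in> carrier_mat d d \<and> Determinant.det A \<noteq> 0 \<and>
      c \<in> carrier_vec d \<and> E = ellipsoid d A c)"

definition vol :: "nat \<Rightarrow> real Matrix.vec set \<Rightarrow> ennreal" where
  "vol d S = emeasure (PiM {..<d} (\<lambda>_. (lborel::real measure))) ((\<lambda>v. \<lambda>i\<in>{..<d}. Matrix.vec_index v i) ` S)"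

definition is_min_vol_ellipsoid :: "nat \<Rightarrow> real Matrix.vec set \<Rightarrow> real Matrix.vec set \<Rightarrow> bool" where
  "is_min_vol_ellipsoid d K E \<longleftrightarrow> is_ellipsoid d E \<and> K \<subseteq> E \<and>
     (\<forall>E'. is_ellipsoid d E' \<and> K \<subseteq> E' \<longrightarrow> vol d E \<le> vol d E')"

text \<open>max / min of \<langle>\<theta>,x\<rangle> over a set (an ellipsoid, where they are attained).\<close>
definition upper :: "real Matrix.vec set \<Rightarrow> real Matrix.vec \<Rightarrow> real" where
  "upper E x = Sup ((\<lambda>\<theta>. ip \<theta> x) ` E)"
definition lower :: "real Matrix.vec set \<Rightarrow> real Matrix.vec \<Rightarrow> real" where
  "lower E x = Inf ((\<lambda>\<theta>. ip \<theta> x) ` E)"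

definition is_matching :: "nat \<Rightarrow> (nat \<times> nat) set \<Rightarrow> bool" where
  "is_matching n M \<longleftrightarrow> M \<subseteq> {..<n} \<times> {..<n} \<and>
     (\<forall>(i,j)\<in>M. \<forall>(i',j')\<in>M. (i = i') = (j = j'))"

definition gft :: "(nat \<Rightarrow> real) \<Rightarrow> (nat \<Rightarrow> real) \<Rightarrow> (nat \<times> nat) set \<Rightarrow> real" where
  "gft c v M = (\<Sum>(i,j)\<in>M. v j - c i)"

definition opt_gft :: "nat \<Rightarrow> (nat \<Rightarrow> real) \<Rightarrow> (nat \<Rightarrow> real) \<Rightarrow> real" where
  "opt_gft n c v = Max (gft c v ` {M. is_matching n M})"

definition accepting_matchings ::
  "nat \<Rightarrow> (nat \<Rightarrow> real) \<Rightarrow> (nat \<Rightarrow> real) \<Rightarrow> (nat \<Rightarrow> real) \<Rightarrow> (nat \<Rightarrow> real) \<Rightarrow> (nat \<times> nat) set set" where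
  "accepting_matchings n c v pS pB =
     {M. is_matching n M \<and> (\<forall>(i,j)\<in>M. c i \<le> pS i \<and> pB j \<le> v j)}"

definition max_card_accepting_matchings ::
  "nat \<Rightarrow> (nat \<Rightarrow> real) \<Rightarrow> (nat \<Rightarrow> real) \<Rightarrow> (nat \<Rightarrow> real) \<Rightarrow> (nat \<Rightarrow> real) \<Rightarrow> (nat \<times> nat) set set" where
  "max_card_accepting_matchings n c v pS pB =
     {M \<in> accepting_matchings n c v pS pB.
        card M = Max (card ` accepting_matchings n c v pS pB)}"

definition round_regret ::
  "nat \<Rightarrow> (nat \<Rightarrow> real) \<Rightarrow> (nat \<Rightarrow> real) \<Rightarrow> (nat \<Rightarrow> real) \<Rightarrow> (nat \<Rightarrow> real) \<Rightarrow> real" where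
  "round_regret n c v pS pB =
     opt_gft n c v - Min (gft c v ` max_card_accepting_matchings n c v pS pB)"

text \<open>Inputs of a round: true types thS, thB, context x, threshold \<delta>, current ellipsoids ES, EB.
  Outputs: posted prices pS, pB and next ellipsoids ES', EB'. All admissible choices
  ("pick one", choice of a GFT-maximising matching) are allowed.\<close>
definition ES_step ::
  "nat \<Rightarrow> nat \<Rightarrow> real \<Rightarrow> (nat \<Rightarrow> real Matrix.vec) \<Rightarrow> (nat \<Rightarrow> real Matrix.vec) \<Rightarrow> real Matrix.vec \<Rightarrow>
   (nat \<Rightarrow> real Matrix.vec set) \<Rightarrow> (nat \<Rightarrow> real Matrix.vec set) \<Rightarrow>
   (nat \<Rightarrow> real) \<Rightarrow> (nat \<Rightarrow> real) \<Rightarrow>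
   (nat \<Rightarrow> real Matrix.vec set) \<Rightarrow> (nat \<Rightarrow> real Matrix.vec set) \<Rightarrow> bool" where
  "ES_step n d \<delta> thS thB x ES EB pS pB ES' EB' \<longleftrightarrow>
     (\<exists>i<n. upper (ES i) x - lower (ES i) x > \<delta> \<and>
        (let p = (upper (ES i) x + lower (ES i) x) / 2 in
          (\<forall>k<n. pS k = p) \<and> (\<forall>k<n. pB k = p) \<and>
          is_min_vol_ellipsoid d
            (ES i \<inter> (if ip (thS i) x \<le> p then {\<theta>. ip \<theta> x \<le> p} else {\<theta>. ip \<theta> x \<ge> p}))
            (ES' i) \<and>
          (\<forall>k<n. k \<noteq> i \<longrightarrow> ES' k = ES k) \<and> (\<forall>k<n. EB' k = EB k)))
   \<or>
     ((\<forall>i<n. \<not> upper (ES i) x - lower (ES i) x > \<delta>) \<and>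
      (\<exists>j<n. upper (EB j) x - lower (EB j) x > \<delta> \<and>
        (let q = (upper (EB j) x + lower (EB j) x) / 2 in
          (\<forall>k<n. pS k = q) \<and> (\<forall>k<n. pB k = q) \<and>
          is_min_vol_ellipsoid d
            (EB j \<inter> (if q \<le> ip (thB j) x then {\<theta>. ip \<theta> x \<ge> q} else {\<theta>. ip \<theta> x \<le> q}))
            (EB' j) \<and>
          (\<forall>k<n. k \<noteq> j \<longrightarrow> EB' k = EB k) \<and> (\<forall>k<n. ES' k = ES k))))
   \<or>
     ((\<forall>i<n. \<not> upper (ES i) x - lower (ES i) x > \<delta>) \<and>
      (\<forall>j<n. \<not> upper (EB j) x - lower (EB j) x > \<delta>) \<and>
      (\<forall>k<n. ES' k = ES k) \<and> (\<forall>k<n. EB' k = EB k) \<and>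
      (\<exists>M. is_matching n M \<and>
         gft (\<lambda>i. upper (ES i) x) (\<lambda>j. lower (EB j) x) M
           = opt_gft n (\<lambda>i. upper (ES i) x) (\<lambda>j. lower (EB j) x) \<and>
         (\<forall>i<n. pS i = (if i \<in> fst ` M then Max ((\<lambda>i'. upper (ES i') x) ` fst ` M) else 0)) \<and>
         (\<forall>j<n. pB j = (if j \<in> snd ` M then Min ((\<lambda>j'. lower (EB j') x) ` snd ` M) else 1))))"

text \<open>A run of the algorithm over rounds 1..T: ES t i / EB t j are the ellipsoids at the
  start of round t, pS t i / pB t j the prices posted in round t.\<close>
definition ES_run ::
  "nat \<Rightarrow> nat \<Rightarrow> nat \<Rightarrow> real \<Rightarrow> (nat \<Rightarrow> real Matrix.vec) \<Rightarrow> (nat \<Rightarrow> real Matrix.vec) \<Rightarrow> (nat \<Rightarrow> real Matrix.vec) \<Rightarrow>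
   (nat \<Rightarrow> nat \<Rightarrow> real Matrix.vec set) \<Rightarrow> (nat \<Rightarrow> nat \<Rightarrow> real Matrix.vec set) \<Rightarrow>
   (nat \<Rightarrow> nat \<Rightarrow> real) \<Rightarrow> (nat \<Rightarrow> nat \<Rightarrow> real) \<Rightarrow> bool" where
  "ES_run n d T \<delta> thS thB x ES EB pS pB \<longleftrightarrow>
     (\<forall>i<n. ES 1 i = unit_ball d) \<and> (\<forall>j<n. EB 1 j = unit_ball d) \<and>
     (\<forall>t\<in>{1..T}. ES_step n d \<delta> thS thB (x t) (ES t) (EB t) (pS t) (pB t) (ES (t+1)) (EB (t+1)))"

end

theory Submission
  imports Defs "HOL-Analysis.Ball_Volume"
begin

text \<open>
  The potential of an ellipsoid is minus the logarithm of its volume relative to the unit ball.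
  An exploration round costs at most \<open>n\<close>, because at a single price every trade is profitable,
  and raises the potential of the explored trader by at least \<open>1 / (8 * d)\<close>; an exploitation
  round costs at most \<open>2 * n * \<delta>\<close>. So the regret is bounded by \<open>8 * n * d\<close> times the
  total final potential, plus \<open>2 * n\<close>.

  To bound the potential, write an ellipsoid as \<open>c + A u\<close> with \<open>u\<close> in the unit ball and let
  \<open>B\<close> be the inverse of \<open>A\<close>. Any ellipsoid covering a central half of it along \<open>x\<close>
  has an inverse matrix \<open>B'\<close> with
  \<open>|B' y|^2 \<le> (1 + \<epsilon>) |B y|^2 + 4 (1 + 1/\<epsilon>) (x, y)^2 / |A^T x|^2\<close> for every \<open>y\<close>.
  With \<open>\<epsilon> = 1 / T\<close> and \<open>|A^T x| > \<delta> / 2\<close>, the Frobenius norm of the inverse stays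
  polynomial in \<open>T\<close> and \<open>d\<close>, hence the potential is \<open>O(d * ln (d * T))\<close>. Minimality
  of the volume enters only through comparison with one explicit cover, so no formula for the
  minimum-volume ellipsoid is needed. If \<open>T \<le> d^2\<close>, the trivial bound \<open>n * T\<close> suffices;
  otherwise \<open>ln (d * T)\<close> is of order \<open>ln T\<close>.
\<close>

subsection \<open>Regret of a single round\<close>

lemma finite_matchings: "finite {M. is_matching n M}"
  by (rule finite_subset[of _ "Pow ({..<n} \<times> {..<n})"]) (auto simp: is_matching_def)

lemma is_matching_finite: "is_matching n M \<Longrightarrow> finite M"
  unfolding is_matching_def by (meson finite_SigmaI finite_lessThan finite_subset)

lemma is_matching_subset: "is_matching n M \<Longrightarrow> M \<subseteq> {..<n} \<times> {..<n}"
  by (simp add: is_matching_def)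

lemma is_matching_empty: "is_matching n {}"
  by (simp add: is_matching_def)

lemma is_matching_inj_on_fst: "is_matching n M \<Longrightarrow> inj_on fst M"
  unfolding is_matching_def inj_on_def by fastforce

lemma is_matching_inj_on_snd: "is_matching n M \<Longrightarrow> inj_on snd M"
  unfolding is_matching_def inj_on_def by fastforce

lemma is_matching_card_le:
  assumes "is_matching n M"
  shows "card M \<le> n"
proof -
  have "card M = card (fst ` M)"
    using is_matching_inj_on_fst[OF assms] by (simp add: card_image)
  also have "\<dots> \<le> card {..<n}"
    using is_matching_subset[OF assms] by (intro card_mono) auto
  finally show ?thesis by simp
qed

lemma gft_alt:
  assumes "is_matching n M"
  shows "gft c v M = (\<Sum>j\<in>snd ` M. v j) - (\<Sum>i\<in>fst ` M. c i)"
  using is_matching_inj_on_fst[OF assms] is_matching_inj_on_snd[OF assms]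
  by (simp add: gft_def sum.reindex case_prod_beta sum_subtractf)

lemma gft_le_opt_gft: "is_matching n M \<Longrightarrow> gft c v M \<le> opt_gft n c v"
  unfolding opt_gft_def by (intro Max_ge) (auto simp: finite_matchings)

lemma opt_gft_attained: "\<exists>M. is_matching n M \<and> opt_gft n c v = gft c v M"
proof -
  have "opt_gft n c v \<in> gft c v ` {M. is_matching n M}"
    unfolding opt_gft_def using is_matching_empty[of n]
    by (intro Max_in) (auto simp: finite_matchings)
  then show ?thesis by auto
qed

lemma finite_accepting_matchings: "finite (accepting_matchings n c v pS pB)"
  by (rule finite_subset[OF _ finite_matchings[of n]]) (auto simp: accepting_matchings_def)

lemma empty_accepting_matching: "{} \<in> accepting_matchings n c v pS pB"
  by (simp add: accepting_matchings_def is_matching_empty)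

text \<open>The empty matching is always accepting, so the \<open>Max\<close> and \<open>Min\<close>
  behind the regret range over nonempty finite sets. Later arguments can thus reason about one
  concrete worst matching of maximum cardinality.\<close>

lemma round_regret_attained:
  "\<exists>M \<in> accepting_matchings n c v pS pB.
     (\<forall>M' \<in> accepting_matchings n c v pS pB. card M' \<le> card M) \<and>
     round_regret n c v pS pB = opt_gft n c v - gft c v M"
proof -
  let ?A = "accepting_matchings n c v pS pB" and ?X = "max_card_accepting_matchings n c v pS pB"
  have "Max (card ` ?A) \<in> card ` ?A"
    using finite_accepting_matchings empty_accepting_matching[of n c v pS pB]
    by (intro Max_in) blast+
  then have "?X \<noteq> {}" by (auto simp: max_card_accepting_matchings_def)
  moreover have "finite ?X"
    using finite_accepting_matchings by (simp add: max_card_accepting_matchings_def)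
  ultimately have "Min (gft c v ` ?X) \<in> gft c v ` ?X" by (intro Min_in) auto
  then obtain M where M: "M \<in> ?X" "Min (gft c v ` ?X) = gft c v M" by auto
  then show ?thesis
    using finite_accepting_matchings[of n c v pS pB]
    by (intro bexI[of _ M]) (auto simp: round_regret_def max_card_accepting_matchings_def)
qed

text \<open>An accepting pair satisfies \<open>c i \<le> p \<le> v j\<close>, so no realised trade
  loses; the benchmark consists of at most \<open>n\<close> trades, each worth at most 1.\<close>

lemma round_regret_single_price:
  assumes c: "\<forall>i<n. 0 \<le> c i" and v: "\<forall>j<n. v j \<le> 1"
    and price: "\<forall>k<n. pS k = p" "\<forall>k<n. pB k = p"
  shows "round_regret n c v pS pB \<le> real n"
proof -
  obtain M where M: "M \<in> accepting_matchings n c v pS pB"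
    and r: "round_regret n c v pS pB = opt_gft n c v - gft c v M"
    using round_regret_attained by blast
  have "0 \<le> gft c v M"
    unfolding gft_def
  proof (intro sum_nonneg)
    fix ij assume "ij \<in> M"
    then show "0 \<le> (case ij of (i, j) \<Rightarrow> v j - c i)"
      using M price by (fastforce simp: accepting_matchings_def is_matching_def)
  qed
  moreover obtain N where N: "is_matching n N" "opt_gft n c v = gft c v N"
    using opt_gft_attained by blast
  have "gft c v N \<le> (\<Sum>ij\<in>N. 1)"
    unfolding gft_def
  proof (intro sum_mono)
    fix ij assume "ij \<in> N"
    then have "fst ij < n" "snd ij < n" using is_matching_subset[OF N(1)] by auto
    then show "(case ij of (i, j) \<Rightarrow> v j - c i) \<le> 1"
      using c v by (auto simp: case_prod_beta intro: order_trans[of _ "v (snd ij)"])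
  qed
  moreover have "real (card N) \<le> real n" using is_matching_card_le[OF N(1)] by simp
  ultimately show ?thesis using r N by simp
qed

text \<open>Replacing the true costs and values by the pessimistic \<open>cu\<close> and
  \<open>vl\<close> takes at most \<open>2 * \<delta>\<close> per pair from the optimum.
  \<open>M\<close> is optimal for these, gains no less at the true ones, and is itself accepting, so
  it can be compared with the realised matching \<open>N\<close>.\<close>

lemma round_regret_segmented_price:
  assumes c: "\<forall>i<n. 0 \<le> c i" "\<forall>i<n. c i \<le> cu i" "\<forall>i<n. cu i \<le> c i + \<delta>"
    and v: "\<forall>j<n. v j \<le> 1" "\<forall>j<n. vl j \<le> v j" "\<forall>j<n. v j \<le> vl j + \<delta>"
    and M: "is_matching n M" "gft cu vl M = opt_gft n cu vl"
    and pS: "\<forall>i<n. pS i = (if i \<in> fst ` M then Max (cu ` fst ` M) else 0)"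
    and pB: "\<forall>j<n. pB j = (if j \<in> snd ` M then Min (vl ` snd ` M) else 1)"
    and \<delta>: "0 \<le> \<delta>"
  shows "round_regret n c v pS pB \<le> 2 * real n * \<delta>"
proof -
  obtain N where N: "N \<in> accepting_matchings n c v pS pB"
    and Nmax: "\<forall>M' \<in> accepting_matchings n c v pS pB. card M' \<le> card N"
    and r: "round_regret n c v pS pB = opt_gft n c v - gft c v N"
    using round_regret_attained by blast
  have matN: "is_matching n N" using N by (simp add: accepting_matchings_def)
  have fin: "finite M" "finite N" using M matN by (auto intro: is_matching_finite)
  have "c i \<le> pS i \<and> pB j \<le> v j" if "(i, j) \<in> M" for i j
  proof -
    have ij: "i < n" "j < n" using that is_matching_subset[OF M(1)] by auto
    have i: "i \<in> fst ` M" "j \<in> snd ` M" using that by force+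
    have "cu i \<le> Max (cu ` fst ` M)" "Min (vl ` snd ` M) \<le> vl j"
      using i fin by auto
    moreover have "c i \<le> cu i" "vl j \<le> v j" using ij c v by auto
    ultimately show ?thesis using i ij pS pB by auto
  qed
  then have "M \<in> accepting_matchings n c v pS pB" using M by (auto simp: accepting_matchings_def)
  then have card: "card M \<le> card N" using Nmax by blast
  have sub: "i < n" "j < n" "c i \<le> pS i" "pB j \<le> v j" if "(i, j) \<in> N" for i j
    using that N matN is_matching_subset by (fastforce simp: accepting_matchings_def)+
  have subM: "i < n" "j < n" if "(i, j) \<in> M" for i j
    using that M is_matching_subset by fastforce+
  \<comment> \<open>Accepting sellers outside \<open>M\<close> have cost \<open>0\<close> and accepting buyers outside \<open>M\<close> have
    value \<open>1\<close>, so exchanging them for traders of \<open>M\<close> loses nothing.\<close>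
  have "(\<Sum>i\<in>fst ` N. c i) = (\<Sum>i\<in>fst ` N \<inter> fst ` M. c i)"
  proof (rule sum.mono_neutral_right)
    show "\<forall>i\<in>fst ` N - fst ` N \<inter> fst ` M. c i = 0"
    proof
      fix i assume "i \<in> fst ` N - fst ` N \<inter> fst ` M"
      then obtain j where "(i, j) \<in> N" "i \<notin> fst ` M" by force
      with sub[of i j] pS c(1) show "c i = 0" by (auto intro: antisym)
    qed
  qed (use fin in auto)
  also have "\<dots> \<le> (\<Sum>i\<in>fst ` M. c i)"
    using fin c subM by (intro sum_mono2) auto
  finally have seller: "(\<Sum>i\<in>fst ` N. c i) \<le> (\<Sum>i\<in>fst ` M. c i)" .
  \<comment> \<open>Deficits \<open>1 - v j\<close> replace values here because, like the costs,
    they are nonnegative and vanish for buyers of \<open>N\<close> outside \<open>M\<close>. As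
    \<open>N\<close> is at least as large as \<open>M\<close>, a smaller total deficit means a
    larger total value.\<close>
  have "(\<Sum>j\<in>snd ` N. 1 - v j) = (\<Sum>j\<in>snd ` N \<inter> snd ` M. 1 - v j)"
  proof (rule sum.mono_neutral_right)
    show "\<forall>j\<in>snd ` N - snd ` N \<inter> snd ` M. 1 - v j = 0"
    proof
      fix j assume "j \<in> snd ` N - snd ` N \<inter> snd ` M"
      then obtain i where "(i, j) \<in> N" "j \<notin> snd ` M" by force
      with sub[of i j] pB v(1) show "1 - v j = 0" by (auto intro: antisym)
    qed
  qed (use fin in auto)
  also have "\<dots> \<le> (\<Sum>j\<in>snd ` M. 1 - v j)"
    using fin v subM by (intro sum_mono2) auto
  finally have "real (card (snd ` N)) - (\<Sum>j\<in>snd ` N. v j) \<le> real (card (snd ` M)) - (\<Sum>j\<in>snd ` M. v j)"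
    by (simp add: sum_subtractf)
  moreover have "card (snd ` N) = card N" "card (snd ` M) = card M"
    using is_matching_inj_on_snd matN M by (auto simp: card_image)
  ultimately have buyer: "(\<Sum>j\<in>snd ` M. v j) \<le> (\<Sum>j\<in>snd ` N. v j)" using card by simp
  have 1: "gft c v M \<le> gft c v N"
    using seller buyer by (simp add: gft_alt[OF matN] gft_alt[OF M(1)])
  have 2: "gft cu vl M \<le> gft c v M"
    unfolding gft_def using subM c v by (intro sum_mono) (auto intro!: diff_mono)
  obtain Q where Q: "is_matching n Q" "opt_gft n c v = gft c v Q"
    using opt_gft_attained by blast
  have "gft c v Q \<le> (\<Sum>ij\<in>Q. (case ij of (i, j) \<Rightarrow> vl j - cu i) + 2 * \<delta>)"
    unfolding gft_def
  proof (intro sum_mono)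
    fix ij assume "ij \<in> Q"
    then have "fst ij < n" "snd ij < n" using is_matching_subset[OF Q(1)] by auto
    then have "v (snd ij) \<le> vl (snd ij) + \<delta>" "cu (fst ij) \<le> c (fst ij) + \<delta>"
      using c v by auto
    then show "(case ij of (i, j) \<Rightarrow> v j - c i) \<le> (case ij of (i, j) \<Rightarrow> vl j - cu i) + 2 * \<delta>"
      by (auto simp: case_prod_beta)
  qed
  also have "\<dots> = gft cu vl Q + 2 * \<delta> * card Q" by (simp add: gft_def sum.distrib)
  also have "\<dots> \<le> opt_gft n cu vl + 2 * \<delta> * n"
    using gft_le_opt_gft[OF Q(1)] is_matching_card_le[OF Q(1)] \<delta>
    by (intro add_mono mult_left_mono) auto
  finally show ?thesis using 1 2 r Q M by (simp add: mult_ac)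
qed

subsection \<open>Volume of ellipsoids\<close>

abbreviation lborel_pow :: "nat \<Rightarrow> (nat \<Rightarrow> real) measure" where
  "lborel_pow d \<equiv> PiM {..<d} (\<lambda>_. lborel::real measure)"

abbreviation coords :: "nat \<Rightarrow> real Matrix.vec \<Rightarrow> nat \<Rightarrow> real" where
  "coords d u \<equiv> (\<lambda>i\<in>{..<d}. Matrix.vec_index u i)"

lemma vec_coords: "u \<in> carrier_vec d \<Longrightarrow> Matrix.vec d (coords d u) = u"
  by (intro eq_vecI) auto

lemma coords_vec: "x \<in> space (lborel_pow d) \<Longrightarrow> coords d (Matrix.vec d x) = x"
  by (auto simp: space_PiM PiE_def extensional_def restrict_def fun_eq_iff)

lemma coords_in_space: "coords d u \<in> space (lborel_pow d)"
  by (auto simp: space_PiM)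

lemma coords_eq_iff:
  assumes "u \<in> carrier_vec d" "w \<in> carrier_vec d"
  shows "coords d u = coords d w \<longleftrightarrow> u = w"
  using vec_coords[OF assms(1)] vec_coords[OF assms(2)] by metis

text \<open>By Fubini, coordinate \<open>i\<close> can be integrated first; with the others fixed,
  the substitution is an affine map of the real line with slope \<open>a i\<close>. The linear form
  serves matrices that change one coordinate, the constant \<open>b\<close> serves
  translations.\<close>

lemma nn_integral_PiM_replace_coord:
  fixes f :: "('i \<Rightarrow> real) \<Rightarrow> ennreal"
  assumes I: "finite I" "i \<in> I" and a: "a i \<noteq> 0"
    and f: "f \<in> borel_measurable (PiM I (\<lambda>_. lborel))"
  shows "ennreal \<bar>a i\<bar> * (\<integral>\<^sup>+x. f (x(i := (\<Sum>j\<in>I. a j * x j) + b)) \<partial>PiM I (\<lambda>_. lborel))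
    = (\<integral>\<^sup>+x. f x \<partial>PiM I (\<lambda>_. lborel))"
proof -
  interpret product_sigma_finite "\<lambda>_::'i. lborel :: real measure" ..
  define J where "J = I - {i}"
  have J: "finite J" "i \<notin> J" "I = insert i J" using I by (auto simp: J_def)
  have f'[measurable]: "f \<in> borel_measurable (PiM (insert i J) (\<lambda>_. lborel))" using f J by simp
  define s where "s x = (\<Sum>j\<in>J. a j * x j) + b" for x :: "'i \<Rightarrow> real"
  have s[measurable]: "s \<in> borel_measurable (PiM J (\<lambda>_. lborel))"
    unfolding s_def by measurable
  have "(\<lambda>x. (\<Sum>j\<in>insert i J. a j * x j) + b) \<in> borel_measurable (PiM (insert i J) (\<lambda>_. lborel))"
    by measurable
  then have "(\<lambda>x. x(i := (\<Sum>j\<in>insert i J. a j * x j) + b))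
      \<in> measurable (PiM (insert i J) (\<lambda>_. lborel)) (PiM (insert i J) (\<lambda>_. lborel))"
    by (intro measurable_fun_upd[where J = "insert i J"]) auto
  then have g[measurable]: "(\<lambda>x. f (x(i := (\<Sum>j\<in>I. a j * x j) + b)))
      \<in> borel_measurable (PiM (insert i J) (\<lambda>_. lborel))"
    unfolding J(3)[symmetric] using f by (rule measurable_compose)
  have "(\<integral>\<^sup>+x. f (x(i := (\<Sum>j\<in>I. a j * x j) + b)) \<partial>PiM I (\<lambda>_. lborel))
    = (\<integral>\<^sup>+x. \<integral>\<^sup>+y. f (x(i := (\<Sum>j\<in>I. a j * (x(i:=y)) j) + b)) \<partial>lborel \<partial>PiM J (\<lambda>_. lborel))"
    unfolding J(3) using J g by (subst product_nn_integral_insert) (auto simp: J(3))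
  also have "\<dots> = (\<integral>\<^sup>+x. \<integral>\<^sup>+y. f (x(i := s x + a i * y)) \<partial>lborel \<partial>PiM J (\<lambda>_. lborel))"
  proof (intro nn_integral_cong)
    fix x :: "'i \<Rightarrow> real" and y :: real
    have "(\<Sum>j\<in>J. a j * (x(i := y)) j) = (\<Sum>j\<in>J. a j * x j)"
      using J by (intro sum.cong) auto
    then show "f (x(i := (\<Sum>j\<in>I. a j * (x(i := y)) j) + b)) = f (x(i := s x + a i * y))"
      using J by (simp add: s_def algebra_simps)
  qed
  also have "ennreal \<bar>a i\<bar> * \<dots>
      = (\<integral>\<^sup>+x. ennreal \<bar>a i\<bar> * (\<integral>\<^sup>+y. f (x(i := s x + a i * y)) \<partial>lborel) \<partial>PiM J (\<lambda>_. lborel))"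
    by (rule nn_integral_cmult[symmetric]) measurable
  also have "\<dots> = (\<integral>\<^sup>+x. \<integral>\<^sup>+y. f (x(i := y)) \<partial>lborel \<partial>PiM J (\<lambda>_. lborel))"
  proof (intro nn_integral_cong)
    fix x assume x[simp]: "x \<in> space (PiM J (\<lambda>_. lborel :: real measure))"
    have "(\<lambda>y. f (x(i := y))) \<in> borel_measurable borel"
      by (rule measurable_compose[OF _ f']) (use x in measurable)
    from nn_integral_real_affine[OF this a, of "s x"]
    show "ennreal \<bar>a i\<bar> * (\<integral>\<^sup>+y. f (x(i := s x + a i * y)) \<partial>lborel) = (\<integral>\<^sup>+y. f (x(i := y)) \<partial>lborel)"
      by simp
  qed
  also have "\<dots> = (\<integral>\<^sup>+x. f x \<partial>PiM I (\<lambda>_. lborel))"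
    unfolding J(3) using J by (subst product_nn_integral_insert) auto
  finally show ?thesis .
qed

section \<open>Linear change of variables by column elimination\<close>

lemma measurable_coords_mult_mat_vec [measurable]:
  assumes "A \<in> carrier_mat d d"
  shows "(\<lambda>x. coords d (A *\<^sub>v Matrix.vec d x)) \<in> measurable (lborel_pow d) (lborel_pow d)"
proof (rule measurable_restrict)
  fix i assume "i \<in> {..<d}"
  then have "(\<lambda>x. Matrix.vec_index (A *\<^sub>v Matrix.vec d x) i) = (\<lambda>x. \<Sum>j<d. A $$ (i, j) * x j)"
    using assms by (auto simp: scalar_prod_def atLeast0LessThan intro!: sum.cong)
  then show "(\<lambda>x. Matrix.vec_index (A *\<^sub>v Matrix.vec d x) i) \<in> measurable (lborel_pow d) lborel"
    by simp
qed

text \<open>The change-of-variables formula is stated for nonnegative integrals instead of images of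
  sets: it then composes along matrix products, and no measurability of images is required.\<close>

definition scales_by_det :: "nat \<Rightarrow> real mat \<Rightarrow> bool" where
  "scales_by_det d A \<longleftrightarrow> (\<forall>f\<in>borel_measurable (lborel_pow d).
     ennreal \<bar>Determinant.det A\<bar> * (\<integral>\<^sup>+x. f (coords d (A *\<^sub>v Matrix.vec d x)) \<partial>lborel_pow d)
       = (\<integral>\<^sup>+x. f x \<partial>lborel_pow d))"

text \<open>The formula for \<open>R\<close>, applied to \<open>f\<close> composed with
  \<open>A\<close>, turns the integral for \<open>A\<close> into the one for \<open>A * R\<close>.
  Elimination needs this direction, and it involves no inverse of \<open>R\<close>.\<close>

lemma scales_by_det_cancel:
  assumes A: "A \<in> carrier_mat d d" and R: "R \<in> carrier_mat d d"
    and "scales_by_det d R" "scales_by_det d (A * R)"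
  shows "scales_by_det d A"
  unfolding scales_by_det_def
proof
  fix f :: "(nat \<Rightarrow> real) \<Rightarrow> ennreal"
  assume f: "f \<in> borel_measurable (lborel_pow d)"
  let ?g = "\<lambda>x. f (coords d (A *\<^sub>v Matrix.vec d x))"
  have g: "?g \<in> borel_measurable (lborel_pow d)"
    by (rule measurable_compose[OF measurable_coords_mult_mat_vec[OF A] f])
  have gR: "?g (coords d (R *\<^sub>v Matrix.vec d x)) = f (coords d ((A * R) *\<^sub>v Matrix.vec d x))" for x
  proof -
    have "Matrix.vec d (coords d (R *\<^sub>v Matrix.vec d x)) = R *\<^sub>v Matrix.vec d x"
      using R by (intro vec_coords) auto
    then show ?thesis using A R by (simp add: assoc_mult_mat_vec[of A d d R d])
  qed
  have "ennreal \<bar>Determinant.det A\<bar> * (\<integral>\<^sup>+x. ?g x \<partial>lborel_pow d)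
     = ennreal \<bar>Determinant.det A\<bar> * (ennreal \<bar>Determinant.det R\<bar> *
         (\<integral>\<^sup>+x. f (coords d ((A * R) *\<^sub>v Matrix.vec d x)) \<partial>lborel_pow d))"
    using bspec[OF assms(3)[unfolded scales_by_det_def] g] by (simp only: gR)
  also have "\<dots> = ennreal \<bar>Determinant.det (A * R)\<bar> *
         (\<integral>\<^sup>+x. f (coords d ((A * R) *\<^sub>v Matrix.vec d x)) \<partial>lborel_pow d)"
    by (simp add: Determinant.det_mult[OF A R] abs_mult ennreal_mult mult.assoc)
  also have "\<dots> = (\<integral>\<^sup>+x. f x \<partial>lborel_pow d)"
    using assms(4) f unfolding scales_by_det_def by simp
  finally show "ennreal \<bar>Determinant.det A\<bar> * (\<integral>\<^sup>+x. ?g x \<partial>lborel_pow d) = (\<integral>\<^sup>+x. f x \<partial>lborel_pow d)" .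
qed

text \<open>As a linear map it changes coordinate \<open>i\<close> only, which is the substitution
  treated in \<open>nn_integral_PiM_replace_coord\<close>.\<close>

definition row_replaced_one :: "nat \<Rightarrow> nat \<Rightarrow> (nat \<Rightarrow> real) \<Rightarrow> real mat" where
  "row_replaced_one d i a =
     Matrix.mat d d (\<lambda>(r, c). if r = i then a c else if r = c then 1 else 0)"

lemma row_replaced_one_carrier [simp]: "row_replaced_one d i a \<in> carrier_mat d d"
  by (simp add: row_replaced_one_def)

lemma det_row_replaced_one:
  assumes i: "i < d"
  shows "Determinant.det (row_replaced_one d i a) = a i"
proof -
  let ?R = "row_replaced_one d i a"
  have del: "mat_delete ?R i i = 1\<^sub>m (d - 1)"
    by (rule eq_matI) (auto simp: mat_delete_def row_replaced_one_def)
  have "Determinant.det ?R = (\<Sum>r<d. ?R $$ (r, i) * cofactor ?R r i)"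
    by (rule laplace_expansion_column[OF row_replaced_one_carrier i])
  also have "\<dots> = (\<Sum>r<d. if r = i then a i * cofactor ?R i i else 0)"
    using i by (intro sum.cong) (auto simp: row_replaced_one_def)
  also have "\<dots> = a i" using i by (simp add: cofactor_def del)
  finally show ?thesis .
qed

lemma scales_by_det_row_replaced_one:
  assumes i: "i < d" and a: "a i \<noteq> 0"
  shows "scales_by_det d (row_replaced_one d i a)"
  unfolding scales_by_det_def
proof
  fix f :: "(nat \<Rightarrow> real) \<Rightarrow> ennreal"
  assume f: "f \<in> borel_measurable (lborel_pow d)"
  have *: "coords d (row_replaced_one d i a *\<^sub>v Matrix.vec d x) = x(i := (\<Sum>j<d. a j * x j) + 0)"
    if "x \<in> space (lborel_pow d)" for x
  proof
    fix r
    consider "r = i" | "r < d" "r \<noteq> i" | "\<not> r < d" "r \<noteq> i" by blast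
    then show "coords d (row_replaced_one d i a *\<^sub>v Matrix.vec d x) r = (x(i := (\<Sum>j<d. a j * x j) + 0)) r"
    proof cases
      case 1
      then show ?thesis using i
        by (auto simp: row_replaced_one_def scalar_prod_def atLeast0LessThan intro!: sum.cong)
    next
      case 2
      have "(\<Sum>j<d. (if r = j then 1 else 0) * x j) = x r"
        using 2 by (simp add: if_distrib[of "\<lambda>t. t * _"] cong: if_cong)
      then show ?thesis using 2
        by (auto simp: row_replaced_one_def scalar_prod_def atLeast0LessThan)
    next
      case 3
      then show ?thesis using that by (auto simp: space_PiM PiE_def extensional_def)
    qed
  qed
  have "(\<integral>\<^sup>+x. f (coords d (row_replaced_one d i a *\<^sub>v Matrix.vec d x)) \<partial>lborel_pow d)
      = (\<integral>\<^sup>+x. f (x(i := (\<Sum>j<d. a j * x j) + 0)) \<partial>lborel_pow d)"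
    by (rule nn_integral_cong) (simp only: *)
  then show "ennreal \<bar>Determinant.det (row_replaced_one d i a)\<bar> *
      (\<integral>\<^sup>+x. f (coords d (row_replaced_one d i a *\<^sub>v Matrix.vec d x)) \<partial>lborel_pow d)
      = (\<integral>\<^sup>+x. f x \<partial>lborel_pow d)"
    using nn_integral_PiM_replace_coord[of "{..<d}" i a f 0] i a f
    by (simp only: det_row_replaced_one[OF i]) simp
qed

text \<open>Right multiplication is a column operation: column \<open>i\<close> is scaled by
  \<open>a i\<close>, and \<open>a c\<close> times the old column \<open>i\<close> is added to every
  other column \<open>c\<close>.\<close>

lemma mult_row_replaced_one_index:
  assumes A: "A \<in> carrier_mat d d" and i: "i < d" and rc: "r < d" "c < d"
  shows "(A * row_replaced_one d i a) $$ (r, c) = A $$ (r, i) * a c + (if c = i then 0 else A $$ (r, c))"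
proof -
  have "(A * row_replaced_one d i a) $$ (r, c)
      = (\<Sum>m<d. A $$ (r, m) * (if m = i then a c else if m = c then 1 else 0))"
    using A i rc by (auto simp: row_replaced_one_def scalar_prod_def atLeast0LessThan intro!: sum.cong)
  also have "\<dots> = (\<Sum>m<d. (if m = i then A $$ (r, i) * a c else 0)
      + (if m = c then if c = i then 0 else A $$ (r, c) else 0))"
    by (intro sum.cong) auto
  also have "\<dots> = A $$ (r, i) * a c + (if c = i then 0 else A $$ (r, c))"
    using i rc by (simp add: sum.distrib)
  finally show ?thesis .
qed

lemma scales_by_det_one: "scales_by_det d (1\<^sub>m d)"
  unfolding scales_by_det_def
proof
  fix f :: "(nat \<Rightarrow> real) \<Rightarrow> ennreal"
  have "(\<integral>\<^sup>+x. f (coords d (1\<^sub>m d *\<^sub>v Matrix.vec d x)) \<partial>lborel_pow d) = (\<integral>\<^sup>+x. f x \<partial>lborel_pow d)"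
  proof (rule nn_integral_cong)
    fix x assume "x \<in> space (lborel_pow d)"
    then have "coords d (Matrix.vec d x) = x" by (rule coords_vec)
    then show "f (coords d (1\<^sub>m d *\<^sub>v Matrix.vec d x)) = f x" by simp
  qed
  then show "ennreal \<bar>Determinant.det (1\<^sub>m d)\<bar> * (\<integral>\<^sup>+x. f (coords d (1\<^sub>m d *\<^sub>v Matrix.vec d x)) \<partial>lborel_pow d)
      = (\<integral>\<^sup>+x. f x \<partial>lborel_pow d)"
    by simp
qed

text \<open>Row \<open>k\<close> is a combination of the unit rows above it; the vector
  \<open>u\<close> records this dependence and lies in the kernel of the transpose. For an
  invertible matrix it follows that row \<open>k\<close> has a nonzero entry at or to the right of
  the diagonal, hence a pivot.\<close>

lemma det_zero_if_row_combination:
  fixes A :: "real mat"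
  assumes A: "A \<in> carrier_mat d d" and k: "k < d"
    and one: "\<And>r c. r < k \<Longrightarrow> c < d \<Longrightarrow> A $$ (r, c) = (if r = c then 1 else 0)"
    and zero: "\<And>j. k \<le> j \<Longrightarrow> j < d \<Longrightarrow> A $$ (k, j) = 0"
  shows "Determinant.det A = 0"
proof -
  define u where "u = Matrix.vec d (\<lambda>j. if j < k then - A $$ (k, j) else if j = k then 1 else 0)"
  have u: "u \<in> carrier_vec d" by (simp add: u_def)
  have "transpose_mat A *\<^sub>v u = 0\<^sub>v d"
  proof (rule eq_vecI)
    fix c assume "c < dim_vec (0\<^sub>v d :: real Matrix.vec)"
    then have c: "c < d" by simp
    have "Matrix.vec_index (transpose_mat A *\<^sub>v u) c
        = (\<Sum>r<d. A $$ (r, c) * (if r < k then - A $$ (k, r) else if r = k then 1 else 0))"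
      using A c by (auto simp: u_def scalar_prod_def atLeast0LessThan intro!: sum.cong)
    also have "\<dots> = (\<Sum>r<d. (if r = c then if c < k then - A $$ (k, c) else 0 else 0)
        + (if r = k then A $$ (k, c) else 0))"
      using one c by (intro sum.cong) auto
    also have "\<dots> = (if c < k then - A $$ (k, c) else 0) + A $$ (k, c)"
      using c k by (simp add: sum.distrib)
    also have "\<dots> = 0" using zero[of c] c by auto
    finally show "Matrix.vec_index (transpose_mat A *\<^sub>v u) c = Matrix.vec_index (0\<^sub>v d) c" using c by simp
  qed (use A in auto)
  moreover have "u \<noteq> 0\<^sub>v d"
  proof
    assume "u = 0\<^sub>v d"
    then have "Matrix.vec_index u k = 0" using k by simp
    then show False using k by (simp add: u_def)
  qed
  moreover have "transpose_mat A \<in> carrier_mat d d" using A by simp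
  ultimately have "Determinant.det (transpose_mat A) = 0"
    using det_0_iff_vec_prod_zero u by blast
  then show ?thesis using Determinant.det_transpose[OF A] by simp
qed

text \<open>
  Gaussian elimination on columns: multiplying \<open>A\<close> on the right by matrices that differ from
  the identity in one row turns the rows of \<open>A\<close> into those of the identity, one by one.
\<close>
lemma scales_by_det_first_rows_one:
  assumes "k \<le> d" "A \<in> carrier_mat d d" "Determinant.det A \<noteq> 0"
    and "\<And>r c. r < k \<Longrightarrow> c < d \<Longrightarrow> A $$ (r, c) = (if r = c then 1 else 0)"
  shows "scales_by_det d A"
  using assms
proof (induction k arbitrary: A rule: inc_induct)
  case base
  then have "A = 1\<^sub>m d" by (intro eq_matI) auto
  then show ?case by (simp add: scales_by_det_one)
next
  case (step k)
  have k: "k < d" by fact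
  have pivot: "scales_by_det d A'"
    if A': "A' \<in> carrier_mat d d" "Determinant.det A' \<noteq> 0" "A' $$ (k, k) \<noteq> 0"
      and one: "\<And>r c. r < k \<Longrightarrow> c < d \<Longrightarrow> A' $$ (r, c) = (if r = c then 1 else 0)" for A'
  proof -
    \<comment> \<open>This column operation scales the pivot to 1 and clears the rest of row
      \<open>k\<close>. The rows above are unchanged because column \<open>k\<close> is zero
      there.\<close>
    define a where "a c = (if c = k then 1 else - A' $$ (k, c)) / A' $$ (k, k)" for c
    let ?R = "row_replaced_one d k a"
    have ak: "a k \<noteq> 0" using A' by (simp add: a_def)
    have "scales_by_det d (A' * ?R)"
    proof (rule step.IH)
      show "A' * ?R \<in> carrier_mat d d" using A' by simp
      show "Determinant.det (A' * ?R) \<noteq> 0"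
        using A' ak k by (simp add: Determinant.det_mult[OF A'(1)] det_row_replaced_one)
      fix r c assume rc: "r < Suc k" "c < d"
      then have "r < d" using k by simp
      show "(A' * ?R) $$ (r, c) = (if r = c then 1 else 0)"
      proof (cases "r = k")
        case False
        then have "r < k" using rc by simp
        then show ?thesis
          using mult_row_replaced_one_index[OF A'(1) k \<open>r < d\<close> rc(2), of a] one[of r k] one[of r c] k rc
          by auto
      next
        case True
        then show ?thesis
          using mult_row_replaced_one_index[OF A'(1) k \<open>r < d\<close> rc(2), of a] A'(3)
          by (auto simp: a_def)
      qed
    qed
    then show ?thesis
      using scales_by_det_cancel[OF A'(1) row_replaced_one_carrier]
        scales_by_det_row_replaced_one[of k d a] k ak by blast
  qed
  show ?case
  proof (cases "A $$ (k, k) = 0")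
    case False
    then show ?thesis using pivot step.prems by blast
  next
    case True
    obtain j where j: "k \<le> j" "j < d" "A $$ (k, j) \<noteq> 0"
      using det_zero_if_row_combination[OF step.prems(1) k] step.prems by blast
    then have jk: "k < j" using True by (cases "j = k") auto
    \<comment> \<open>With this choice column \<open>j\<close> is added to column \<open>k\<close>,
      which makes the pivot nonzero and takes the place of a column swap. Rows above
      \<open>k\<close> are unaffected since \<open>j\<close> exceeds \<open>k\<close>.\<close>
    define a :: "nat \<Rightarrow> real" where "a c = (if c = j \<or> c = k then 1 else 0)" for c
    let ?R = "row_replaced_one d j a"
    have ind: "(A * ?R) $$ (r, c) = A $$ (r, j) * a c + (if c = j then 0 else A $$ (r, c))"
      if "r < d" "c < d" for r c
      using mult_row_replaced_one_index[OF step.prems(1) j(2) that] .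
    have "scales_by_det d (A * ?R)"
    proof (rule pivot)
      show "A * ?R \<in> carrier_mat d d" using step.prems by simp
      show "Determinant.det (A * ?R) \<noteq> 0"
        using step.prems j by (simp add: Determinant.det_mult[OF step.prems(1)] det_row_replaced_one a_def)
      show "(A * ?R) $$ (k, k) \<noteq> 0" using ind[OF k k] jk j True by (simp add: a_def)
      fix r c assume rc: "r < k" "c < d"
      then show "(A * ?R) $$ (r, c) = (if r = c then 1 else 0)"
        using ind[of r c] step.prems(3)[of r j] step.prems(3)[of r c] jk j k by (auto simp: a_def)
    qed
    then show ?thesis
      using scales_by_det_cancel[OF step.prems(1) row_replaced_one_carrier]
        scales_by_det_row_replaced_one[of j d a] j by (simp add: a_def)
  qed
qed

lemma nn_integral_lborel_pow_linear:
  assumes "A \<in> carrier_mat d d" "Determinant.det A \<noteq> 0" "f \<in> borel_measurable (lborel_pow d)"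
  shows "ennreal \<bar>Determinant.det A\<bar> * (\<integral>\<^sup>+x. f (coords d (A *\<^sub>v Matrix.vec d x)) \<partial>lborel_pow d)
    = (\<integral>\<^sup>+x. f x \<partial>lborel_pow d)"
  using scales_by_det_first_rows_one[of 0 d A] assms unfolding scales_by_det_def by auto

text \<open>Coordinates are shifted one at a time, by induction on the number \<open>k\<close>
  already shifted; each shift is a coordinate replacement whose linear form is the coordinate
  itself.\<close>

lemma nn_integral_lborel_pow_translate:
  fixes f :: "(nat \<Rightarrow> real) \<Rightarrow> ennreal"
  assumes f: "f \<in> borel_measurable (lborel_pow d)"
  shows "(\<integral>\<^sup>+x. f (\<lambda>i\<in>{..<d}. x i + c i) \<partial>lborel_pow d) = (\<integral>\<^sup>+x. f x \<partial>lborel_pow d)"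
proof -
  have "(\<integral>\<^sup>+x. f (\<lambda>i\<in>{..<d}. if i < k then x i + c i else x i) \<partial>lborel_pow d) = (\<integral>\<^sup>+x. f x \<partial>lborel_pow d)"
    if "k \<le> d" for k
    using that
  proof (induction k)
    case 0
    have "(\<lambda>i\<in>{..<d}. x i) = x" if "x \<in> space (lborel_pow d)" for x
      using that by (auto simp: space_PiM)
    then show ?case by (intro nn_integral_cong) (simp only: not_less0 if_False)
  next
    case (Suc k)
    let ?g = "\<lambda>x. f (\<lambda>i\<in>{..<d}. if i < k then x i + c i else x i)"
    have "(\<lambda>x. \<lambda>i\<in>{..<d}. if i < k then x i + c i else x i) \<in> measurable (lborel_pow d) (lborel_pow d)"
      by measurable
    then have g: "?g \<in> borel_measurable (lborel_pow d)" using f by (rule measurable_compose)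
    have s: "(\<Sum>j<d. (if j = k then 1 else 0) * x j) = x k" for x :: "nat \<Rightarrow> real"
      using Suc.prems by (simp add: if_distrib[of "\<lambda>t. t * _"] cong: if_cong)
    have e: "(\<lambda>i\<in>{..<d}. if i < k then (x(k := x k + c k)) i + c i else (x(k := x k + c k)) i)
        = (\<lambda>i\<in>{..<d}. if i < Suc k then x i + c i else x i)" for x
      by (auto simp: fun_eq_iff less_Suc_eq)
    have "(\<integral>\<^sup>+x. ?g (x(k := x k + c k)) \<partial>lborel_pow d) = (\<integral>\<^sup>+x. ?g x \<partial>lborel_pow d)"
      using nn_integral_PiM_replace_coord[of "{..<d}" k "\<lambda>j. if j = k then 1 else 0" ?g "c k"] Suc.prems g
      unfolding s by simp
    then show ?case using Suc.IH[OF Suc_leD[OF Suc.prems]] unfolding e by (rule trans)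
  qed
  from this[of d] have "(\<integral>\<^sup>+x. f (\<lambda>i\<in>{..<d}. if i < d then x i + c i else x i) \<partial>lborel_pow d)
      = (\<integral>\<^sup>+x. f x \<partial>lborel_pow d)" by simp
  moreover have "(\<lambda>i\<in>{..<d}. if i < d then x i + c i else x i) = (\<lambda>i\<in>{..<d}. x i + c i)" for x
    by (auto simp: fun_eq_iff)
  ultimately show ?thesis by simp
qed

section \<open>Volume of the unit ball and of its affine images\<close>

lemma ip_self: "ip u u = (\<Sum>i<dim_vec u. (Matrix.vec_index u i)\<^sup>2)"
  by (auto simp: ip_def scalar_prod_def atLeast0LessThan power2_eq_square)

lemma coords_unit_ball:
  "coords d ` unit_ball d = {f. sqrt (\<Sum>i<d. (f i)\<^sup>2) \<le> 1} \<inter> space (lborel_pow d)"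
proof (intro equalityI subsetI)
  fix f assume "f \<in> coords d ` unit_ball d"
  then obtain u where "u \<in> carrier_vec d" "ip u u \<le> 1" "f = coords d u"
    by (auto simp: unit_ball_def)
  then show "f \<in> {f. sqrt (\<Sum>i<d. (f i)\<^sup>2) \<le> 1} \<inter> space (lborel_pow d)"
    using coords_in_space[of u d] by (simp add: ip_self)
next
  fix f assume f: "f \<in> {f. sqrt (\<Sum>i<d. (f i)\<^sup>2) \<le> 1} \<inter> space (lborel_pow d)"
  then have "Matrix.vec d f \<in> unit_ball d" by (simp add: unit_ball_def ip_self)
  moreover have "coords d (Matrix.vec d f) = f" using f coords_vec by blast
  ultimately show "f \<in> coords d ` unit_ball d" by (metis imageI)
qed

lemma vol_unit_ball: "vol d (unit_ball d) = ennreal (unit_ball_vol (real d))"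
  using emeasure_cball_aux[of "{..<d}" 1] by (simp add: vol_def coords_unit_ball)

lemma sets_coords_unit_ball: "coords d ` unit_ball d \<in> sets (lborel_pow d)"
proof -
  have "{x \<in> space (lborel_pow d). sqrt (\<Sum>i<d. (x i)\<^sup>2) \<le> 1} \<in> sets (lborel_pow d)" by measurable
  then show ?thesis unfolding coords_unit_ball by (simp add: Int_def conj_commute)
qed

lemma obtain_inverse_mat:
  fixes A :: "real mat"
  assumes "A \<in> carrier_mat d d" "Determinant.det A \<noteq> 0"
  obtains B where "B \<in> carrier_mat d d" "A * B = 1\<^sub>m d" "B * A = 1\<^sub>m d"
  using det_non_zero_imp_unit[OF assms, of "()"] unfolding Units_def
  by (auto simp: ring_mat_def)

lemma mult_mat_vec_inverse:
  fixes A B :: "real mat"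
  assumes "A \<in> carrier_mat d d" "B \<in> carrier_mat d d" "A * B = 1\<^sub>m d" "u \<in> carrier_vec d"
  shows "A *\<^sub>v (B *\<^sub>v u) = u"
  using assms by (simp flip: assoc_mult_mat_vec)

text \<open>Translating by \<open>c\<close> and then substituting \<open>A\<close> turns the
  indicator of the ellipsoid into that of the unit ball, at the price of the factor given by the
  determinant.\<close>

lemma vol_ellipsoid:
  assumes A: "A \<in> carrier_mat d d" and det: "Determinant.det A \<noteq> 0" and c: "c \<in> carrier_vec d"
  shows "vol d (ellipsoid d A c) = ennreal (\<bar>Determinant.det A\<bar> * unit_ball_vol (real d))"
proof -
  obtain B where B: "B \<in> carrier_mat d d" "A * B = 1\<^sub>m d" "B * A = 1\<^sub>m d"
    using obtain_inverse_mat[OF A det] .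
  let ?U = "coords d ` unit_ball d" and ?S = "coords d ` ellipsoid d A c"
  \<comment> \<open>Membership in the image only provides some unit-ball vector \<open>w\<close>
    with the same image as \<open>u\<close>; invertibility of \<open>A\<close> identifies the
    two.\<close>
  have mem: "coords d (c + A *\<^sub>v u) \<in> ?S \<longleftrightarrow> coords d u \<in> ?U" if u: "u \<in> carrier_vec d" for u
  proof -
    have inj: "u = w" if "w \<in> carrier_vec d" "c + A *\<^sub>v u = c + A *\<^sub>v w" for w
    proof -
      have "A *\<^sub>v u = A *\<^sub>v w"
      proof (rule eq_vecI)
        fix i assume "i < dim_vec (A *\<^sub>v w)"
        then show "Matrix.vec_index (A *\<^sub>v u) i = Matrix.vec_index (A *\<^sub>v w) i"
          using arg_cong[OF that(2), of "\<lambda>z. Matrix.vec_index z i"] A c by simp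
      qed (use A in simp)
      then show ?thesis
        using mult_mat_vec_inverse[OF B(1) A B(3)] u that(1) by metis
    qed
    have "coords d (c + A *\<^sub>v u) \<in> ?S \<longleftrightarrow> (\<exists>w\<in>unit_ball d. coords d (c + A *\<^sub>v u) = coords d (c + A *\<^sub>v w))"
      by (auto simp: ellipsoid_def)
    also have "\<dots> \<longleftrightarrow> (\<exists>w\<in>unit_ball d. c + A *\<^sub>v u = c + A *\<^sub>v w)"
    proof (rule bex_cong[OF refl], rule coords_eq_iff)
      fix w
      show "c + A *\<^sub>v u \<in> carrier_vec d" "c + A *\<^sub>v w \<in> carrier_vec d"
        using A by (intro carrier_vecI, simp)+
    qed
    also have "\<dots> \<longleftrightarrow> u \<in> unit_ball d"
      using inj by (auto simp: unit_ball_def)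
    also have "\<dots> \<longleftrightarrow> coords d u \<in> ?U"
      using u by (auto simp: coords_eq_iff unit_ball_def image_iff)
    finally show ?thesis .
  qed
  \<comment> \<open>Measurability comes from writing the ellipsoid as the preimage of the unit ball
    under the inverse affine map.\<close>
  have S: "?S \<in> sets (lborel_pow d)"
  proof -
    let ?T = "\<lambda>x. coords d (B *\<^sub>v Matrix.vec d (\<lambda>i\<in>{..<d}. x i - Matrix.vec_index c i))"
    have T: "?T \<in> measurable (lborel_pow d) (lborel_pow d)"
      by (rule measurable_compose[OF _ measurable_coords_mult_mat_vec[OF B(1)]]) measurable
    have "x \<in> ?S \<longleftrightarrow> ?T x \<in> ?U" if x: "x \<in> space (lborel_pow d)" for x
    proof -
      define y where "y = Matrix.vec d (\<lambda>i\<in>{..<d}. x i - Matrix.vec_index c i)"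
      have y: "y \<in> carrier_vec d" by (simp add: y_def)
      have "c + y = Matrix.vec d x" using c by (intro eq_vecI) (auto simp: y_def)
      then have "coords d (c + A *\<^sub>v (B *\<^sub>v y)) = x"
        using mult_mat_vec_inverse[OF A B(1,2) y] coords_vec[OF x] by simp
      with mem[of "B *\<^sub>v y"] show ?thesis using B y by (auto simp: y_def)
    qed
    moreover have "?S \<subseteq> space (lborel_pow d)" using coords_in_space by blast
    ultimately have "?S = ?T -` ?U \<inter> space (lborel_pow d)" by blast
    then show ?thesis using measurable_sets[OF T sets_coords_unit_ball] by simp
  qed
  let ?f = "\<lambda>x. indicator ?S x :: ennreal"
  let ?h = "\<lambda>x. ?f (\<lambda>i\<in>{..<d}. x i + Matrix.vec_index c i)"
  have f: "?f \<in> borel_measurable (lborel_pow d)" using S by simp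
  have "(\<lambda>x. \<lambda>i\<in>{..<d}. x i + Matrix.vec_index c i) \<in> measurable (lborel_pow d) (lborel_pow d)"
    by measurable
  then have h: "?h \<in> borel_measurable (lborel_pow d)" using f by (rule measurable_compose)
  have "vol d (ellipsoid d A c) = (\<integral>\<^sup>+x. ?h x \<partial>lborel_pow d)"
    using S nn_integral_lborel_pow_translate[OF f] by (simp add: vol_def)
  also have "\<dots> = ennreal \<bar>Determinant.det A\<bar> * (\<integral>\<^sup>+x. ?h (coords d (A *\<^sub>v Matrix.vec d x)) \<partial>lborel_pow d)"
    using nn_integral_lborel_pow_linear[OF A det h] by simp
  also have "(\<integral>\<^sup>+x. ?h (coords d (A *\<^sub>v Matrix.vec d x)) \<partial>lborel_pow d) = (\<integral>\<^sup>+x. indicator ?U x \<partial>lborel_pow d)"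
  proof (rule nn_integral_cong)
    fix x assume x: "x \<in> space (lborel_pow d)"
    have "(\<lambda>i\<in>{..<d}. coords d (A *\<^sub>v Matrix.vec d x) i + Matrix.vec_index c i)
        = coords d (c + A *\<^sub>v Matrix.vec d x)"
      using A c by (auto simp: fun_eq_iff)
    then show "?h (coords d (A *\<^sub>v Matrix.vec d x)) = indicator ?U x"
      using mem[of "Matrix.vec d x"] coords_vec[OF x] by (simp add: indicator_def)
  qed
  also have "\<dots> = ennreal (unit_ball_vol (real d))"
    using sets_coords_unit_ball vol_unit_ball by (simp add: vol_def)
  finally show ?thesis by (simp add: ennreal_mult)
qed

subsection \<open>Geometry of ellipsoids\<close>

lemma ip_comm: "u \<in> carrier_vec d \<Longrightarrow> w \<in> carrier_vec d \<Longrightarrow> ip u w = ip w u"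
  unfolding ip_def by (rule comm_scalar_prod)

lemma ip_add_left:
  "\<lbrakk>u \<in> carrier_vec d; v \<in> carrier_vec d; w \<in> carrier_vec d\<rbrakk> \<Longrightarrow> ip (u + v) w = ip u w + ip v w"
  unfolding ip_def by (rule add_scalar_prod_distrib)

lemma ip_add_right:
  "\<lbrakk>u \<in> carrier_vec d; v \<in> carrier_vec d; w \<in> carrier_vec d\<rbrakk> \<Longrightarrow> ip u (v + w) = ip u v + ip u w"
  unfolding ip_def by (rule scalar_prod_add_distrib)

lemma ip_smult_left: "u \<in> carrier_vec d \<Longrightarrow> w \<in> carrier_vec d \<Longrightarrow> ip (a \<cdot>\<^sub>v u) w = a * ip u w"
  unfolding ip_def by simp

lemma ip_smult_right: "u \<in> carrier_vec d \<Longrightarrow> w \<in> carrier_vec d \<Longrightarrow> ip u (a \<cdot>\<^sub>v w) = a * ip u w"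
  unfolding ip_def by simp

lemma ip_nonneg: "0 \<le> ip u u"
  by (simp add: ip_self sum_nonneg)

lemma ip_zero_imp_zero_vec:
  assumes "v \<in> carrier_vec d" "ip v v = 0"
  shows "v = 0\<^sub>v d"
proof -
  have "(\<Sum>i<d. (Matrix.vec_index v i)\<^sup>2) = 0" using assms by (simp add: ip_self)
  then have "\<forall>i\<in>{..<d}. (Matrix.vec_index v i)\<^sup>2 = 0" by (subst (asm) sum_nonneg_eq_0_iff) auto
  then show ?thesis using assms by (intro eq_vecI) auto
qed

lemma ip_add_self:
  assumes "u \<in> carrier_vec d" "v \<in> carrier_vec d"
  shows "ip (u + v) (u + v) = ip u u + 2 * ip u v + ip v v"
  using assms ip_comm[of v d u] by (simp add: ip_add_left[of _ d] ip_add_right[of _ d])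

lemma ip_mult_mat_vec:
  assumes "A \<in> carrier_mat d d" "u \<in> carrier_vec d" "x \<in> carrier_vec d"
  shows "ip (A *\<^sub>v u) x = ip u (transpose_mat A *\<^sub>v x)"
proof -
  have "ip (A *\<^sub>v u) x = ip x (A *\<^sub>v u)" by (rule ip_comm[of _ d]) (use assms in auto)
  also have "\<dots> = ip (transpose_mat A *\<^sub>v x) u"
    using transpose_vec_mult_scalar[OF assms(1,2,3)] by (simp add: ip_def)
  also have "\<dots> = ip u (transpose_mat A *\<^sub>v x)" by (rule ip_comm[of _ d]) (use assms in auto)
  finally show ?thesis .
qed

lemma ip_cauchy_schwarz:
  assumes "u \<in> carrier_vec d" "w \<in> carrier_vec d"
  shows "(ip u w)\<^sup>2 \<le> ip u u * ip w w"
  using assms Cauchy_Schwarz_ineq_sum[of "Matrix.vec_index u" "Matrix.vec_index w" "{..<d}"]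
  unfolding ip_self by (simp add: ip_def scalar_prod_def atLeast0LessThan)

text \<open>Expanding the square of \<open>\<epsilon> u - v\<close> bounds the cross term. A small
  \<epsilon> keeps the factor of \<open>u\<close> close to 1, so that the estimate survives
  iteration over many rounds.\<close>

lemma ip_add_self_le:
  assumes u: "u \<in> carrier_vec d" and v: "v \<in> carrier_vec d" and e: "0 < \<epsilon>"
  shows "ip (u + v) (u + v) \<le> (1 + \<epsilon>) * ip u u + (1 + 1 / \<epsilon>) * ip v v"
proof -
  have "0 \<le> ip (\<epsilon> \<cdot>\<^sub>v u + (-1) \<cdot>\<^sub>v v) (\<epsilon> \<cdot>\<^sub>v u + (-1) \<cdot>\<^sub>v v)" by (rule ip_nonneg)
  also have "\<dots> = \<epsilon>\<^sup>2 * ip u u - 2 * \<epsilon> * ip u v + ip v v"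
    using u v
    by (subst ip_add_self[of _ d]) (auto simp: ip_smult_left[of _ d] ip_smult_right[of _ d] power2_eq_square)
  finally have "2 * ip u v \<le> \<epsilon> * ip u u + ip v v / \<epsilon>"
    using e by (simp add: field_simps power2_eq_square)
  then show ?thesis using u v by (simp add: ip_add_self[of _ d] algebra_simps)
qed

text \<open>Inverting the parametrisation gives a quadratic inequality in the inverse matrix, the
  form in which two ellipsoids can be compared.\<close>

lemma mem_ellipsoid_iff:
  assumes A: "A \<in> carrier_mat d d" and B: "B \<in> carrier_mat d d" "A * B = 1\<^sub>m d" "B * A = 1\<^sub>m d"
    and c: "c \<in> carrier_vec d" and y: "y \<in> carrier_vec d"
  shows "c + y \<in> ellipsoid d A c \<longleftrightarrow> ip (B *\<^sub>v y) (B *\<^sub>v y) \<le> 1"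
proof
  assume "c + y \<in> ellipsoid d A c"
  then obtain u where u: "u \<in> carrier_vec d" "ip u u \<le> 1" "c + y = c + A *\<^sub>v u"
    by (auto simp: ellipsoid_def unit_ball_def)
  have "y = A *\<^sub>v u"
  proof (rule eq_vecI)
    fix i assume "i < dim_vec (A *\<^sub>v u)"
    then show "Matrix.vec_index y i = Matrix.vec_index (A *\<^sub>v u) i"
      using arg_cong[OF u(3), of "\<lambda>z. Matrix.vec_index z i"] A c y by simp
  qed (use A y in simp)
  then show "ip (B *\<^sub>v y) (B *\<^sub>v y) \<le> 1"
    using mult_mat_vec_inverse[OF B(1) A B(3) u(1)] u by simp
next
  assume "ip (B *\<^sub>v y) (B *\<^sub>v y) \<le> 1"
  then have "B *\<^sub>v y \<in> unit_ball d" using B y by (auto simp: unit_ball_def)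
  then show "c + y \<in> ellipsoid d A c"
    unfolding ellipsoid_def using mult_mat_vec_inverse[OF A B(1,2) y] by (metis (mono_tags, lifting) mem_Collect_eq)
qed

lemma ellipsoid_subset_carrier:
  "A \<in> carrier_mat d d \<Longrightarrow> c \<in> carrier_vec d \<Longrightarrow> ellipsoid d A c \<subseteq> carrier_vec d"
  by (auto simp: ellipsoid_def unit_ball_def intro!: add_carrier_vec)

lemma ip_ellipsoid:
  assumes "A \<in> carrier_mat d d" "c \<in> carrier_vec d" "x \<in> carrier_vec d" "u \<in> carrier_vec d"
  shows "ip (c + A *\<^sub>v u) x = ip c x + ip u (transpose_mat A *\<^sub>v x)"
proof -
  have "A *\<^sub>v u \<in> carrier_vec d" using assms by auto
  then show ?thesis using assms by (simp add: ip_add_left[of _ d] ip_mult_mat_vec)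
qed

lemma ip_ellipsoid_bound:
  assumes A: "A \<in> carrier_mat d d" and c: "c \<in> carrier_vec d" and x: "x \<in> carrier_vec d"
    and "\<theta> \<in> ellipsoid d A c"
  shows "\<bar>ip \<theta> x - ip c x\<bar> \<le> sqrt (ip (transpose_mat A *\<^sub>v x) (transpose_mat A *\<^sub>v x))"
proof -
  let ?h = "transpose_mat A *\<^sub>v x"
  have h: "?h \<in> carrier_vec d" using A x by auto
  obtain u where u: "u \<in> carrier_vec d" "ip u u \<le> 1" "\<theta> = c + A *\<^sub>v u"
    using assms(4) by (auto simp: ellipsoid_def unit_ball_def)
  have "(ip u ?h)\<^sup>2 \<le> ip u u * ip ?h ?h" by (rule ip_cauchy_schwarz[OF u(1) h])
  also have "\<dots> \<le> ip ?h ?h" using u(2) ip_nonneg[of ?h] by (simp add: mult_left_le_one_le ip_nonneg)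
  finally have "\<bar>ip u ?h\<bar> \<le> sqrt (ip ?h ?h)" using real_le_rsqrt by fastforce
  then show ?thesis by (simp add: u(3) ip_ellipsoid[OF A c x u(1)])
qed

lemma ip_ellipsoid_attained:
  assumes A: "A \<in> carrier_mat d d" and c: "c \<in> carrier_vec d" and x: "x \<in> carrier_vec d"
    and \<sigma>: "\<bar>\<sigma>\<bar> \<le> 1"
  shows "\<exists>\<theta>\<in>ellipsoid d A c. ip \<theta> x
      = ip c x + \<sigma> * sqrt (ip (transpose_mat A *\<^sub>v x) (transpose_mat A *\<^sub>v x))"
proof -
  let ?h = "transpose_mat A *\<^sub>v x"
  let ?s = "sqrt (ip ?h ?h)"
  \<comment> \<open>The extreme point is the normalised \<open>?h\<close>. If \<open>?s\<close> is
    0, division by zero makes \<open>?u\<close> the zero vector, and the claim holds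
    trivially.\<close>
  let ?u = "(\<sigma> / ?s) \<cdot>\<^sub>v ?h"
  have h: "?h \<in> carrier_vec d" using A x by auto
  have s: "?s * ?s = ip ?h ?h" by (simp add: ip_nonneg)
  have "ip ?u ?u = (\<sigma> / ?s)\<^sup>2 * ip ?h ?h"
    using h by (simp add: ip_smult_left[of _ d] ip_smult_right[of _ d] power2_eq_square)
  also have "\<dots> \<le> 1"
    using \<sigma> abs_square_le_1[of \<sigma>] ip_nonneg[of ?h] by (cases "ip ?h ?h = 0") (auto simp: power_divide)
  finally have "?u \<in> unit_ball d" using h by (simp add: unit_ball_def)
  moreover have "ip (c + A *\<^sub>v ?u) x = ip c x + \<sigma> * ?s"
    using h real_div_sqrt[OF ip_nonneg, of ?h]
    by (subst ip_ellipsoid[OF A c x]) (auto simp: ip_smult_left[of _ d] simp flip: times_divide_eq_right)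
  ultimately show ?thesis unfolding ellipsoid_def by blast
qed

lemma upper_ellipsoid:
  assumes "A \<in> carrier_mat d d" "c \<in> carrier_vec d" "x \<in> carrier_vec d"
  shows "upper (ellipsoid d A c) x
    = ip c x + sqrt (ip (transpose_mat A *\<^sub>v x) (transpose_mat A *\<^sub>v x))"
  unfolding upper_def
proof (rule cSup_eq_maximum)
  show "ip c x + sqrt (ip (transpose_mat A *\<^sub>v x) (transpose_mat A *\<^sub>v x))
      \<in> (\<lambda>\<theta>. ip \<theta> x) ` ellipsoid d A c"
    using ip_ellipsoid_attained[OF assms, of 1] by force
qed (use ip_ellipsoid_bound[OF assms] in \<open>fastforce simp: abs_le_iff\<close>)

lemma lower_ellipsoid:
  assumes "A \<in> carrier_mat d d" "c \<in> carrier_vec d" "x \<in> carrier_vec d"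
  shows "lower (ellipsoid d A c) x
    = ip c x - sqrt (ip (transpose_mat A *\<^sub>v x) (transpose_mat A *\<^sub>v x))"
  unfolding lower_def
proof (rule cInf_eq_minimum)
  show "ip c x - sqrt (ip (transpose_mat A *\<^sub>v x) (transpose_mat A *\<^sub>v x))
      \<in> (\<lambda>\<theta>. ip \<theta> x) ` ellipsoid d A c"
    using ip_ellipsoid_attained[OF assms, of "-1"] by force
qed (use ip_ellipsoid_bound[OF assms] in \<open>fastforce simp: abs_le_iff\<close>)

text \<open>Split \<open>y\<close> into \<open>z\<close> orthogonal to \<open>x\<close> and a
  multiple of the extreme direction \<open>w\<close>. Central symmetry of the slice orthogonal to
  \<open>x\<close> gives \<open>?q' z \<le> ?q z\<close>, the points \<open>c\<close> and
  \<open>c + w\<close> give \<open>?q' w \<le> 4\<close>, and \<open>ip_add_self_le\<close> combines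
  the two parts.\<close>

lemma half_ellipsoid_cover_quadratic_bound:
  fixes A B A' B' :: "real mat"
  assumes A: "A \<in> carrier_mat d d" and B: "B \<in> carrier_mat d d" "A * B = 1\<^sub>m d" "B * A = 1\<^sub>m d"
    and A': "A' \<in> carrier_mat d d" and B': "B' \<in> carrier_mat d d" "A' * B' = 1\<^sub>m d" "B' * A' = 1\<^sub>m d"
    and c: "c \<in> carrier_vec d" and c': "c' \<in> carrier_vec d"
    and x: "x \<in> carrier_vec d" and y: "y \<in> carrier_vec d"
    and h_def: "h = transpose_mat A *\<^sub>v x" and h0: "ip h h > 0"
    and cover: "\<And>\<theta>. \<theta> \<in> ellipsoid d A c \<Longrightarrow> ip c x \<le> ip \<theta> x \<Longrightarrow> \<theta> \<in> ellipsoid d A' c'"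
    and e: "0 < \<epsilon>"
  shows "ip (B' *\<^sub>v y) (B' *\<^sub>v y) \<le> (1 + \<epsilon>) * ip (B *\<^sub>v y) (B *\<^sub>v y) + 4 * (1 + 1 / \<epsilon>) * ((ip x y)\<^sup>2 / ip h h)"
proof -
  let ?q = "\<lambda>z. ip (B *\<^sub>v z) (B *\<^sub>v z)" and ?q' = "\<lambda>z. ip (B' *\<^sub>v z) (B' *\<^sub>v z)"
  have h: "h \<in> carrier_vec d" using A x h_def by auto
  have BB: "B *\<^sub>v z \<in> carrier_vec d" "B' *\<^sub>v z \<in> carrier_vec d" if "z \<in> carrier_vec d" for z
    using B B' that by auto
  define a where "a = B' *\<^sub>v (c - c')"
  have a: "a \<in> carrier_vec d" using B' c c' by (auto simp: a_def)
  \<comment> \<open>Relative to the new centre \<open>c'\<close>, a point \<open>c + z\<close> is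
    the offset \<open>c - c'\<close> plus \<open>z\<close>; the vector \<open>a\<close> is the image
    of that offset under \<open>B'\<close>.\<close>
  have incl: "ip (a + B' *\<^sub>v z) (a + B' *\<^sub>v z) \<le> 1"
    if z: "z \<in> carrier_vec d" "?q z \<le> 1" "0 \<le> ip z x" for z
  proof -
    have "c + z \<in> ellipsoid d A c" using mem_ellipsoid_iff[OF A B c z(1)] z by simp
    moreover have "ip c x \<le> ip (c + z) x" using z c x by (simp add: ip_add_left[of _ d])
    ultimately have "c + z \<in> ellipsoid d A' c'" by (rule cover)
    moreover have "c + z = c' + ((c - c') + z)" using c c' z by (intro eq_vecI) auto
    ultimately have "?q' ((c - c') + z) \<le> 1"
      using mem_ellipsoid_iff[OF A' B' c', of "(c - c') + z"] c c' z by simp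
    moreover have "B' *\<^sub>v ((c - c') + z) = a + B' *\<^sub>v z"
      unfolding a_def by (rule mult_add_distrib_mat_vec[OF B'(1)]) (use c c' z in auto)
    ultimately show ?thesis by simp
  qed
  have smult: "?q (k \<cdot>\<^sub>v z) = k\<^sup>2 * ?q z" "?q' (k \<cdot>\<^sub>v z) = k\<^sup>2 * ?q' z" if "z \<in> carrier_vec d" for k z
    using that BB[OF that]
    by (simp_all add: mult_mat_vec[OF B(1)] mult_mat_vec[OF B'(1)] ip_smult_left[of _ d]
        ip_smult_right[of _ d] power2_eq_square)
  \<comment> \<open>On the hyperplane orthogonal to \<open>x\<close> both \<open>c + z\<close> and \<open>c - z\<close> are covered; averaging removes
    the unknown centre \<open>c'\<close>.\<close>
  have orth: "?q' z \<le> ?q z" if z: "z \<in> carrier_vec d" "ip z x = 0" for z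
  proof (cases "?q z = 0")
    case True
    have "B *\<^sub>v z = 0\<^sub>v d" using ip_zero_imp_zero_vec[OF BB(1)[OF z(1)] True] .
    moreover have "A *\<^sub>v 0\<^sub>v d = 0\<^sub>v d" using A by (intro eq_vecI) auto
    ultimately have "z = 0\<^sub>v d" using mult_mat_vec_inverse[OF A B(1,2) z(1)] by simp
    then have "z = 0 \<cdot>\<^sub>v z" by (intro eq_vecI) auto
    then show ?thesis using smult(2)[OF z(1), of 0] ip_nonneg by simp
  next
    case False
    then have pos: "?q z > 0" using ip_nonneg[of "B *\<^sub>v z"] by linarith
    define k where "k = 1 / sqrt (?q z)"
    have k2: "k\<^sup>2 * ?q z = 1" using pos by (simp add: k_def power_divide)
    have "ip (a + B' *\<^sub>v (m \<cdot>\<^sub>v z)) (a + B' *\<^sub>v (m \<cdot>\<^sub>v z)) \<le> 1" if "m = k \<or> m = -k" for m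
      using z x that k2 smult(1)[OF z(1), of m] by (intro incl) (auto simp: ip_smult_left[of _ d])
    then have "ip a a + 2 * (m * ip a (B' *\<^sub>v z)) + m\<^sup>2 * ?q' z \<le> 1" if "m = k \<or> m = -k" for m
      using that a BB[OF z(1)] z
      by (simp add: ip_add_self[of _ d] mult_mat_vec[OF B'(1)] ip_smult_right[of _ d]
          ip_smult_left[of _ d] power2_eq_square mult.assoc)
    from this[of k] this[of "-k"] have "k\<^sup>2 * ?q' z \<le> 1" using ip_nonneg[of a] by simp
    then have "k\<^sup>2 * ?q' z \<le> k\<^sup>2 * ?q z" using k2 by simp
    moreover have "k\<^sup>2 > 0" using pos by (simp add: k_def)
    ultimately show ?thesis by simp
  qed
  define s where "s = sqrt (ip h h)"
  have s: "s > 0" "s * s = ip h h" using h0 by (auto simp: s_def)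
  \<comment> \<open>The point \<open>c + w\<close> maximises the inner product with \<open>x\<close>
    over the old ellipsoid; it lies on the boundary, as \<open>qw\<close> confirms.\<close>
  define w where "w = (1 / s) \<cdot>\<^sub>v (A *\<^sub>v h)"
  have Ah: "A *\<^sub>v h \<in> carrier_vec d" using A h by auto
  have w: "w \<in> carrier_vec d" using Ah by (simp add: w_def)
  have wx: "ip w x = s"
    using Ah x s ip_mult_mat_vec[OF A h x] by (simp add: w_def ip_smult_left[of _ d] h_def[symmetric] field_simps)
  have Bw: "B *\<^sub>v w = (1 / s) \<cdot>\<^sub>v h"
    using Ah mult_mat_vec_inverse[OF B(1) A B(3) h] by (simp add: w_def mult_mat_vec[OF B(1)])
  have qw: "?q w = 1"
    using h s h0 by (simp add: Bw ip_smult_left[of _ d] ip_smult_right[of _ d] field_simps)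
  \<comment> \<open>Both \<open>c\<close> and \<open>c + w\<close> are covered, so \<open>a\<close>
    and its sum with the image of \<open>w\<close> have norm at most 1. The image of
    \<open>w\<close> then has norm at most 2; \<open>ip_add_self_le\<close> with parameter 1 gives
    the square.\<close>
  have q'w: "?q' w \<le> 4"
  proof -
    have "ip (a + B' *\<^sub>v (0 \<cdot>\<^sub>v w)) (a + B' *\<^sub>v (0 \<cdot>\<^sub>v w)) \<le> 1"
      using w x smult(1)[OF w, of 0] by (intro incl) (auto simp: ip_smult_left[of _ d])
    then have a1: "ip a a \<le> 1"
      using a BB[OF w] w by (simp add: ip_add_self[of _ d] mult_mat_vec[OF B'(1)] ip_smult_right[of _ d]
          ip_smult_left[of _ d])
    have "ip (a + B' *\<^sub>v w) (a + B' *\<^sub>v w) \<le> 1"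
      using w qw wx s by (intro incl) auto
    moreover have "B' *\<^sub>v w = (a + B' *\<^sub>v w) + (-1) \<cdot>\<^sub>v a" using a B' by (intro eq_vecI) auto
    moreover have "ip ((a + B' *\<^sub>v w) + (-1) \<cdot>\<^sub>v a) ((a + B' *\<^sub>v w) + (-1) \<cdot>\<^sub>v a)
        \<le> (1 + 1) * ip (a + B' *\<^sub>v w) (a + B' *\<^sub>v w) + (1 + 1 / 1) * ip ((-1) \<cdot>\<^sub>v a) ((-1) \<cdot>\<^sub>v a)"
      by (rule ip_add_self_le[of _ d]) (use a BB[OF w] in auto)
    moreover have "ip ((-1) \<cdot>\<^sub>v a) ((-1) \<cdot>\<^sub>v a) = ip a a"
      using a by (simp add: ip_smult_left[of _ d] ip_smult_right[of _ d])
    ultimately show ?thesis using a1 by simp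
  qed
  define t where "t = ip x y / s"
  define z where "z = y + (- t) \<cdot>\<^sub>v w"
  have z: "z \<in> carrier_vec d" using y w by (simp add: z_def)
  have zx: "ip z x = 0"
    using y w x wx s ip_comm[OF x y]
    by (simp add: z_def ip_add_left[of _ d] ip_smult_left[of _ d] t_def)
  have y_eq: "y = z + t \<cdot>\<^sub>v w" using y w by (intro eq_vecI) (auto simp: z_def)
  have B_y: "B *\<^sub>v y = B *\<^sub>v z + t \<cdot>\<^sub>v (B *\<^sub>v w)" "B' *\<^sub>v y = B' *\<^sub>v z + t \<cdot>\<^sub>v (B' *\<^sub>v w)"
    unfolding y_eq using z w B B' by (simp_all add: mult_add_distrib_mat_vec mult_mat_vec)
  \<comment> \<open>The images of \<open>z\<close> and \<open>w\<close> under \<open>B\<close> are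
    orthogonal because \<open>z\<close> is orthogonal to \<open>x\<close>. Hence \<open>?q\<close>
    splits without a cross term.\<close>
  have "ip (B *\<^sub>v z) h = ip (A *\<^sub>v (B *\<^sub>v z)) x"
    unfolding h_def by (rule ip_mult_mat_vec[symmetric, OF A BB(1)[OF z] x])
  also have "\<dots> = 0" using mult_mat_vec_inverse[OF A B(1,2) z] zx by simp
  finally have "ip (B *\<^sub>v z) (B *\<^sub>v w) = 0"
    using BB(1)[OF z] h by (simp add: Bw ip_smult_right[of _ d])
  then have qy: "?q y = ?q z + t\<^sup>2"
    using BB(1)[OF z] BB(1)[OF w] qw
    by (simp add: B_y ip_add_self[of _ d] ip_smult_right[of _ d] ip_smult_left[of _ d] power2_eq_square)
  have "?q' y \<le> (1 + \<epsilon>) * ?q' z + (1 + 1 / \<epsilon>) * ip (t \<cdot>\<^sub>v (B' *\<^sub>v w)) (t \<cdot>\<^sub>v (B' *\<^sub>v w))"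
    unfolding B_y by (rule ip_add_self_le[of _ d]) (use BB z w e in auto)
  also have "ip (t \<cdot>\<^sub>v (B' *\<^sub>v w)) (t \<cdot>\<^sub>v (B' *\<^sub>v w)) = t\<^sup>2 * ?q' w"
    using BB(2)[OF w] by (simp add: ip_smult_right[of _ d] ip_smult_left[of _ d] power2_eq_square)
  also have "(1 + \<epsilon>) * ?q' z + (1 + 1 / \<epsilon>) * (t\<^sup>2 * ?q' w) \<le> (1 + \<epsilon>) * ?q y + (1 + 1 / \<epsilon>) * (t\<^sup>2 * 4)"
  proof (intro add_mono mult_left_mono)
    show "?q' z \<le> ?q y" using orth[OF z zx] qy zero_le_power2[of t] by linarith
  qed (use q'w e in auto)
  also have "t\<^sup>2 = (ip x y)\<^sup>2 / ip h h" using s by (simp add: t_def power_divide power2_eq_square)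
  finally show ?thesis by (simp only: mult_ac)
qed

section \<open>Frobenius norm and determinant\<close>

definition frobenius_sq :: "nat \<Rightarrow> real mat \<Rightarrow> real" where
  "frobenius_sq d B = (\<Sum>i<d. ip (B *\<^sub>v unit_vec d i) (B *\<^sub>v unit_vec d i))"

lemma index_le_frobenius_sq:
  assumes B: "B \<in> carrier_mat d d" and ij: "i < d" "j < d"
  shows "\<bar>B $$ (i, j)\<bar> \<le> sqrt (frobenius_sq d B)"
proof -
  have "(B $$ (i, j))\<^sup>2 = (Matrix.vec_index (B *\<^sub>v unit_vec d j) i)\<^sup>2"
    using B ij by simp
  also have "\<dots> \<le> ip (B *\<^sub>v unit_vec d j) (B *\<^sub>v unit_vec d j)"
    unfolding ip_self using B ij by (intro member_le_sum) auto
  also have "\<dots> \<le> frobenius_sq d B"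
    unfolding frobenius_sq_def using ij by (intro member_le_sum) (auto simp: ip_nonneg)
  finally have "(B $$ (i, j))\<^sup>2 \<le> frobenius_sq d B" .
  then show ?thesis using real_le_rsqrt[of "\<bar>B $$ (i, j)\<bar>"] by simp
qed

lemma frobenius_sq_one: "frobenius_sq d (1\<^sub>m d) = real d"
proof -
  have "ip (unit_vec d i) (unit_vec d i) = 1" if "i < d" for i
    using that by (simp add: ip_def)
  then show ?thesis by (simp add: frobenius_sq_def)
qed

text \<open>In the Leibniz formula each of the \<open>fact d\<close> products has \<open>d\<close>
  factors bounded by the Frobenius norm, and \<open>fact d\<close> is at most \<open>d ^ d\<close>.
  The crude factor only adds \<open>d * ln d\<close> to the potential.\<close>

lemma abs_det_le_frobenius_sq:
  assumes B: "B \<in> carrier_mat d d"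
  shows "\<bar>Determinant.det B\<bar> \<le> (real d * sqrt (frobenius_sq d B)) ^ d"
proof -
  let ?P = "{p. p permutes {0..<d}}"
  have "\<bar>Determinant.det B\<bar> \<le> (\<Sum>p\<in>?P. \<bar>signof p * (\<Prod>i = 0..<d. B $$ (i, p i))\<bar>)"
    unfolding det_def'[OF B] by (rule sum_abs)
  also have "\<dots> \<le> (\<Sum>p\<in>?P. sqrt (frobenius_sq d B) ^ d)"
  proof (rule sum_mono)
    fix p assume p: "p \<in> ?P"
    have "\<bar>signof p * (\<Prod>i = 0..<d. B $$ (i, p i))\<bar> = (\<Prod>i = 0..<d. \<bar>B $$ (i, p i)\<bar>)"
      by (simp add: abs_mult abs_prod sign_def)
    also have "\<dots> \<le> (\<Prod>i = 0..<d. sqrt (frobenius_sq d B))"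
    proof (rule prod_mono)
      fix i assume i: "i \<in> {0..<d}"
      then have "p i < d" using p permutes_in_image[of p "{0..<d}" i] by auto
      then show "0 \<le> \<bar>B $$ (i, p i)\<bar> \<and> \<bar>B $$ (i, p i)\<bar> \<le> sqrt (frobenius_sq d B)"
        using i index_le_frobenius_sq[OF B] by simp
    qed
    finally show "\<bar>signof p * (\<Prod>i = 0..<d. B $$ (i, p i))\<bar> \<le> sqrt (frobenius_sq d B) ^ d" by simp
  qed
  also have "\<dots> = fact d * sqrt (frobenius_sq d B) ^ d" by (simp add: card_permutations)
  also have "\<dots> \<le> real d ^ d * sqrt (frobenius_sq d B) ^ d"
  proof -
    have "(fact d :: real) \<le> of_nat (d ^ d)" by (rule fact_le_power)
    moreover have "0 \<le> frobenius_sq d B" unfolding frobenius_sq_def by (intro sum_nonneg ip_nonneg)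
    ultimately show ?thesis by (intro mult_right_mono) auto
  qed
  finally show ?thesis by (simp add: power_mult_distrib)
qed

subsection \<open>Volume decrease of a central cut\<close>

text \<open>For \<open>v = 0\<close> this is the identity, since the coefficient \<open>2 / 0\<close> is \<open>0\<close>.\<close>
definition reflection :: "nat \<Rightarrow> real Matrix.vec \<Rightarrow> real mat" where
  "reflection d v = Matrix.mat d d (\<lambda>(i, j). (if i = j then 1 else 0)
     - 2 / ip v v * Matrix.vec_index v i * Matrix.vec_index v j)"

lemma reflection_carrier [simp]: "reflection d v \<in> carrier_mat d d"
  by (simp add: reflection_def)

lemma transpose_reflection: "transpose_mat (reflection d v) = reflection d v"
  by (rule eq_matI) (auto simp: reflection_def mult_ac)

lemma reflection_mult_vec:
  assumes v: "v \<in> carrier_vec d" and u: "u \<in> carrier_vec d"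
  shows "reflection d v *\<^sub>v u = u + (- 2 / ip v v * ip v u) \<cdot>\<^sub>v v"
proof (rule eq_vecI)
  fix i assume "i < dim_vec (u + (- 2 / ip v v * ip v u) \<cdot>\<^sub>v v)"
  then have i: "i < d" using v by simp
  have "Matrix.vec_index (reflection d v *\<^sub>v u) i
      = (\<Sum>j<d. ((if i = j then 1 else 0) - 2 / ip v v * Matrix.vec_index v i * Matrix.vec_index v j) * Matrix.vec_index u j)"
    using i u by (simp add: reflection_def scalar_prod_def atLeast0LessThan)
  also have "\<dots> = (\<Sum>j<d. (if i = j then Matrix.vec_index u j else 0))
      - 2 / ip v v * Matrix.vec_index v i * (\<Sum>j<d. Matrix.vec_index v j * Matrix.vec_index u j)"
    unfolding sum_distrib_left sum_subtractf[symmetric] by (intro sum.cong) (auto simp: algebra_simps)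
  also have "\<dots> = Matrix.vec_index (u + (- 2 / ip v v * ip v u) \<cdot>\<^sub>v v) i"
    using i u v by (simp add: ip_def scalar_prod_def atLeast0LessThan)
  finally show "Matrix.vec_index (reflection d v *\<^sub>v u) i
      = Matrix.vec_index (u + (- 2 / ip v v * ip v u) \<cdot>\<^sub>v v) i" .
qed (use v in \<open>simp add: reflection_def\<close>)

lemma reflection_mult_reflection:
  assumes v: "v \<in> carrier_vec d"
  shows "reflection d v * reflection d v = 1\<^sub>m d"
proof (rule eq_matI)
  fix i j assume "i < dim_row (1\<^sub>m d :: real mat)" "j < dim_col (1\<^sub>m d :: real mat)"
  then have ij: "i < d" "j < d" by auto
  define k where "k = 2 / ip v v"
  define c where "c = reflection d v *\<^sub>v unit_vec d j"
  have vc: "Matrix.vec_index v l = 0" if "ip v v = 0" "l < d" for l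
    using ip_zero_imp_zero_vec[OF v that(1)] that by simp
  have c: "c = unit_vec d j + (- k * Matrix.vec_index v j) \<cdot>\<^sub>v v"
    unfolding c_def using reflection_mult_vec[OF v, of "unit_vec d j"] v ij
    by (simp add: k_def ip_def)
  have cc: "c \<in> carrier_vec d" using v by (simp add: c)
  have vcj: "ip v c = Matrix.vec_index v j - k * Matrix.vec_index v j * ip v v"
    unfolding c using v ij by (simp add: ip_add_right[of _ d] ip_smult_right[of _ d]) (simp add: ip_def)
  have col: "Matrix.col (reflection d v) j = c"
    unfolding c_def using ij by (intro eq_vecI) (auto simp: reflection_def)
  have "(reflection d v * reflection d v) $$ (i, j) = Matrix.vec_index (reflection d v *\<^sub>v c) i"
    using ij col by (simp add: reflection_def)
  also have "reflection d v *\<^sub>v c = c + (- k * ip v c) \<cdot>\<^sub>v v"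
    using reflection_mult_vec[OF v cc] by (simp add: k_def)
  also have "Matrix.vec_index (c + (- k * ip v c) \<cdot>\<^sub>v v) i
      = (if i = j then 1 else 0) + Matrix.vec_index v i * Matrix.vec_index v j * (k * k * ip v v - 2 * k)"
    using v ij unfolding vcj by (simp add: c algebra_simps)
  \<comment> \<open>The last factor vanishes because \<open>k * ip v v = 2\<close>; if
    \<open>ip v v = 0\<close>, then \<open>k = 0\<close> by the convention for division.\<close>
  also have "\<dots> = (if i = j then 1 else 0)"
    using vc ij by (cases "ip v v = 0") (auto simp: k_def)
  finally show "(reflection d v * reflection d v) $$ (i, j) = 1\<^sub>m d $$ (i, j)" using ij by simp
qed (auto simp: reflection_def)

text \<open>The Householder reflection along the difference of two unit vectors swaps them. If they
  coincide, it is the identity.\<close>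

lemma ex_reflection_unit_vec:
  assumes g: "g \<in> carrier_vec d" "ip g g = 1" and d: "0 < d"
  obtains R where "R \<in> carrier_mat d d" "transpose_mat R = R" "R * R = 1\<^sub>m d" "R *\<^sub>v unit_vec d 0 = g"
proof -
  let ?e = "unit_vec d 0 :: real Matrix.vec"
  define v where "v = ?e + (-1) \<cdot>\<^sub>v g"
  have v: "v \<in> carrier_vec d" using g by (simp add: v_def)
  have ee: "ip ?e ?e = 1" "ip ?e g = Matrix.vec_index g 0" using d g by (auto simp: ip_def)
  have vv: "ip v v = 2 - 2 * Matrix.vec_index g 0"
    using g ee unfolding v_def
    by (subst ip_add_self[of _ d]) (auto simp: ip_smult_left[of _ d] ip_smult_right[of _ d])
  have ve: "ip v ?e = 1 - Matrix.vec_index g 0"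
    using g ee ip_comm[of g d ?e] unfolding v_def by (simp add: ip_add_left[of _ d] ip_smult_left[of _ d])
  have "reflection d v *\<^sub>v ?e = ?e + (- 2 / ip v v * ip v ?e) \<cdot>\<^sub>v v"
    by (rule reflection_mult_vec[OF v]) simp
  also have "\<dots> = g"
  proof (cases "ip v v = 0")
    case True
    have "Matrix.vec_index v i = 0" if "i < d" for i
      using ip_zero_imp_zero_vec[OF v True] that by simp
    then have "Matrix.vec_index ?e i = Matrix.vec_index g i" if "i < d" for i
      using that g unfolding v_def by (simp add: algebra_simps)
    then show ?thesis using True g v by (intro eq_vecI) auto
  next
    case False
    then have "- 2 / ip v v * ip v ?e = -1" unfolding vv ve by (simp add: field_simps)
    then show ?thesis using g by (intro eq_vecI) (auto simp: v_def)
  qed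
  finally show ?thesis
    using that[of "reflection d v"] transpose_reflection reflection_mult_reflection[OF v] by simp
qed

text \<open>Here \<open>t\<close> is the first coordinate of a point of the half ball and
  \<open>r\<close> its squared length. For \<open>r = 1\<close> the slack is
  \<open>2 * \<alpha> * t * (1 - t)\<close> over \<open>(1 - \<alpha>)\<^sup>2\<close>, so the
  covering ellipsoid touches the half ball at the equator \<open>t = 0\<close> and the pole
  \<open>t = 1\<close>.\<close>

lemma half_ball_inequality:
  fixes \<alpha> t :: real
  assumes "0 < \<alpha>" "\<alpha> < 1 / 2" "0 \<le> t" "t \<le> 1" "r \<le> 1"
  shows "((t - \<alpha>) / (1 - \<alpha>))\<^sup>2 + (r - t\<^sup>2) * (1 - 2 * \<alpha>) / (1 - \<alpha>)\<^sup>2 \<le> 1"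
proof -
  have "(t - \<alpha>)\<^sup>2 + (r - t\<^sup>2) * (1 - 2 * \<alpha>) \<le> (t - \<alpha>)\<^sup>2 + (1 - t\<^sup>2) * (1 - 2 * \<alpha>)"
    using assms by (intro add_left_mono mult_right_mono) auto
  also have "\<dots> = (1 - \<alpha>)\<^sup>2 - 2 * \<alpha> * (t * (1 - t))"
    by (simp add: power2_eq_square algebra_simps)
  also have "\<dots> \<le> (1 - \<alpha>)\<^sup>2" using assms by simp
  finally show ?thesis
    using assms by (simp add: power_divide add_divide_distrib[symmetric])
qed

text \<open>The short axis contributes at most \<open>exp (- 1 / (4 * d))\<close>. The other axes
  grow only to second order in \<alpha>, together by at most \<open>exp (1 / (16 * d))\<close>, so a
  net decrease remains.\<close>

lemma shrink_factor_le:
  assumes d: "d \<ge> (1::nat)" and \<alpha>: "\<alpha> = 1 / (4 * real d)"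
  shows "(1 - \<alpha>) * ((1 - \<alpha>) / sqrt (1 - 2 * \<alpha>)) ^ (d - 1) \<le> exp (- 1 / (8 * real d))"
proof -
  have a: "0 < \<alpha>" "\<alpha> \<le> 1 / 4" using d by (auto simp: \<alpha> field_simps)
  let ?a = "(1 - \<alpha>) / sqrt (1 - 2 * \<alpha>)"
  have a0: "?a \<ge> 0" using a by simp
  have "?a\<^sup>2 = (1 - \<alpha>)\<^sup>2 / (1 - 2 * \<alpha>)" using a by (simp add: power_divide)
  also have "\<dots> \<le> 1 + 2 * \<alpha>\<^sup>2"
  proof -
    have "(1 - \<alpha>)\<^sup>2 \<le> (1 + 2 * \<alpha>\<^sup>2) * (1 - 2 * \<alpha>)"
    proof -
      have "(1 + 2 * \<alpha>\<^sup>2) * (1 - 2 * \<alpha>) - (1 - \<alpha>)\<^sup>2 = \<alpha>\<^sup>2 * (1 - 4 * \<alpha>)"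
        by (simp add: power2_eq_square algebra_simps)
      moreover have "\<dots> \<ge> 0" using a by simp
      ultimately show ?thesis by simp
    qed
    then show ?thesis using a by (simp add: pos_divide_le_eq)
  qed
  also have "\<dots> \<le> exp (2 * \<alpha>\<^sup>2)" by (rule exp_ge_add_one_self)
  also have "\<dots> = (exp (\<alpha>\<^sup>2))\<^sup>2" by (simp flip: exp_double)
  finally have "?a \<le> exp (\<alpha>\<^sup>2)" by (rule power2_le_imp_le) simp
  then have "?a ^ (d - 1) \<le> exp (\<alpha>\<^sup>2) ^ (d - 1)" using a0 by (rule power_mono)
  also have "\<dots> = exp (real (d - 1) * \<alpha>\<^sup>2)" by (simp add: exp_of_nat_mult)
  also have "\<dots> \<le> exp (real d * \<alpha>\<^sup>2)" by (simp add: mult_right_mono)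
  also have "real d * \<alpha>\<^sup>2 = 1 / (16 * real d)" using d by (simp add: \<alpha> power2_eq_square field_simps)
  finally have 1: "?a ^ (d - 1) \<le> exp (1 / (16 * real d))" .
  have "1 - \<alpha> \<le> exp (- \<alpha>)" using exp_ge_add_one_self[of "- \<alpha>"] by simp
  then have "(1 - \<alpha>) * ?a ^ (d - 1) \<le> exp (- \<alpha>) * exp (1 / (16 * real d))"
    using 1 a a0 by (intro mult_mono) auto
  also have "\<dots> = exp (- \<alpha> + 1 / (16 * real d))" by (rule exp_add[symmetric])
  also have "\<dots> \<le> exp (- 1 / (8 * real d))" using d by (simp add: \<alpha> field_simps)
  finally show ?thesis .
qed

text \<open>Pulling back by \<open>A\<close> gives a half ball with normal \<open>g\<close>, and
  \<open>R\<close> moves \<open>g\<close> to the first axis. There an ellipsoid centred at \<alpha>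
  on this axis, with semi-axes \<open>b\<close> along it and \<open>a\<close> across it, covers the
  half ball; mapping forward only multiplies volumes by a constant.\<close>

lemma half_ellipsoid_cover:
  fixes A :: "real mat"
  assumes d: "d \<ge> 1" and A: "A \<in> carrier_mat d d" and det: "Determinant.det A \<noteq> 0"
    and c: "c \<in> carrier_vec d" and x: "x \<in> carrier_vec d"
    and h_def: "h = transpose_mat A *\<^sub>v x" and h0: "ip h h > 0"
  shows "\<exists>A' c'. A' \<in> carrier_mat d d \<and> Determinant.det A' \<noteq> 0 \<and> c' \<in> carrier_vec d
      \<and> {\<theta> \<in> ellipsoid d A c. ip c x \<le> ip \<theta> x} \<subseteq> ellipsoid d A' c'
      \<and> \<bar>Determinant.det A'\<bar> \<le> exp (- 1 / (8 * real d)) * \<bar>Determinant.det A\<bar>"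
proof -
  have h: "h \<in> carrier_vec d" using A x h_def by auto
  define s where "s = sqrt (ip h h)"
  have s: "s > 0" "s * s = ip h h" using h0 by (auto simp: s_def)
  define g where "g = (1 / s) \<cdot>\<^sub>v h"
  have g: "g \<in> carrier_vec d" "ip g g = 1"
    using h s by (auto simp: g_def ip_smult_left[of _ d] ip_smult_right[of _ d] field_simps)
  obtain R where R: "R \<in> carrier_mat d d" "transpose_mat R = R" "R * R = 1\<^sub>m d" "R *\<^sub>v unit_vec d 0 = g"
    using ex_reflection_unit_vec[OF g] d by auto
  \<comment> \<open>The optimal shift \<open>1 / (d + 1)\<close> makes \<open>a\<close> infinite for \<open>d = 1\<close>; this smaller one treats all
    dimensions alike.\<close>
  define \<alpha> where "\<alpha> = 1 / (4 * real d)"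
  define b where "b = 1 - \<alpha>"
  define a where "a = b / sqrt (1 - 2 * \<alpha>)"
  have al: "0 < \<alpha>" "\<alpha> \<le> 1 / 4" using d by (auto simp: \<alpha>_def field_simps)
  then have ab: "0 < b" "0 < a" "a\<^sup>2 = b\<^sup>2 / (1 - 2 * \<alpha>)" by (auto simp: b_def a_def power_divide)
  define D where "D = Matrix.mat d d (\<lambda>(i, j). if i \<noteq> j then 0 else if i = 0 then b else a)"
  have D: "D \<in> carrier_mat d d" by (simp add: D_def)
  have "Determinant.det D = prod_list (diag_mat D)"
    by (rule det_upper_triangular[OF _ D]) (auto simp: D_def)
  also have "\<dots> = (\<Prod>i = 0..<d. if i = 0 then b else a)" by (simp add: prod_list_diag_prod D_def)
  also have "\<dots> = b * (\<Prod>i\<in>{0..<d} - {0}. if i = 0 then b else a)"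
    using d by (subst prod.remove[of _ 0]) auto
  also have "(\<Prod>i\<in>{0..<d} - {0}. if i = 0 then b else a) = (\<Prod>i\<in>{0..<d} - {0}. a)"
    by (intro prod.cong) auto
  also have "\<dots> = a ^ (d - 1)" using d by simp
  finally have detD: "Determinant.det D = b * a ^ (d - 1)" .
  have "Determinant.det R * Determinant.det R = 1"
    using Determinant.det_mult[OF R(1) R(1)] R(3) by simp
  then have detR: "\<bar>Determinant.det R\<bar> = 1"
    by (metis abs_1 abs_mult_self_eq abs_mult power2_eq_1_iff power2_eq_square abs_minus_cancel)
  define A' where "A' = A * (R * D)"
  have A': "A' \<in> carrier_mat d d" using A R D by (simp add: A'_def)
  have detA': "Determinant.det A' = Determinant.det A * (Determinant.det R * Determinant.det D)"
    unfolding A'_def using Determinant.det_mult[OF A, of "R * D"] Determinant.det_mult[OF R(1) D] R D by simp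
  have "\<bar>Determinant.det A'\<bar> = \<bar>Determinant.det A\<bar> * (b * a ^ (d - 1))"
    unfolding detA' abs_mult detR detD using ab by (simp add: abs_mult)
  also have "\<dots> \<le> \<bar>Determinant.det A\<bar> * exp (- 1 / (8 * real d))"
    using shrink_factor_le[OF d \<alpha>_def] unfolding a_def b_def by (intro mult_left_mono) auto
  finally have detA'_le: "\<bar>Determinant.det A'\<bar> \<le> exp (- 1 / (8 * real d)) * \<bar>Determinant.det A\<bar>"
    by (simp add: mult.commute)
  have detA'0: "Determinant.det A' \<noteq> 0" using detA' det detR detD ab by auto
  define c' where "c' = c + \<alpha> \<cdot>\<^sub>v (A *\<^sub>v g)"
  have Ag: "A *\<^sub>v g \<in> carrier_vec d" using A g by auto
  have c': "c' \<in> carrier_vec d" using c Ag by (simp add: c'_def)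
  have "\<theta> \<in> ellipsoid d A' c'" if \<theta>: "\<theta> \<in> ellipsoid d A c" "ip c x \<le> ip \<theta> x" for \<theta>
  proof -
    obtain u where u: "u \<in> carrier_vec d" "ip u u \<le> 1" "\<theta> = c + A *\<^sub>v u"
      using \<theta>(1) by (auto simp: ellipsoid_def unit_ball_def)
    have uh: "0 \<le> ip u h" using \<theta>(2) ip_ellipsoid[OF A c x u(1)] by (simp add: u(3) h_def)
    define w where "w = R *\<^sub>v u"
    have w: "w \<in> carrier_vec d" using R u by (auto simp: w_def)
    have Rw: "R *\<^sub>v w = u" unfolding w_def by (rule mult_mat_vec_inverse[OF R(1) R(1) R(3) u(1)])
    have ww: "ip w w \<le> 1"
    proof -
      have "ip w w = ip u (R *\<^sub>v w)" unfolding w_def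
        using ip_mult_mat_vec[OF R(1) u(1), of "R *\<^sub>v u"] R(2) w by (simp add: w_def)
      then show ?thesis using Rw u by simp
    qed
    define t where "t = Matrix.vec_index w 0"
    have "t = ip w (unit_vec d 0)" using w d by (simp add: t_def ip_def)
    also have "\<dots> = ip u g" unfolding w_def using ip_mult_mat_vec[OF R(1) u(1), of "unit_vec d 0"] R by simp
    also have "\<dots> = ip u h / s" using u h by (simp add: g_def ip_smult_right[of _ d])
    finally have t0: "0 \<le> t" using uh s by simp
    have split: "ip w w = t\<^sup>2 + (\<Sum>i\<in>{..<d} - {0}. (Matrix.vec_index w i)\<^sup>2)"
      using w d by (simp add: ip_self t_def sum.remove[of "{..<d}" 0])
    then have "t\<^sup>2 \<le> 1" using ww by (smt (verit) sum_nonneg zero_le_power2)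
    then have t1: "t \<le> 1" using power2_le_imp_le[of t 1] by simp
    \<comment> \<open>The parameter of \<open>\<theta>\<close> in the new ellipsoid: the rotated
      point \<open>w\<close> relative to the shifted centre, each coordinate divided by its
      semi-axis.\<close>
    define z where "z = Matrix.vec d (\<lambda>i. if i = 0 then (t - \<alpha>) / b else Matrix.vec_index w i / a)"
    have z: "z \<in> carrier_vec d" by (simp add: z_def)
    have "ip z z = ((t - \<alpha>) / b)\<^sup>2 + (\<Sum>i\<in>{..<d} - {0}. (Matrix.vec_index w i / a)\<^sup>2)"
      using d by (simp add: ip_self z_def sum.remove[of "{..<d}" 0])
    also have "(\<Sum>i\<in>{..<d} - {0}. (Matrix.vec_index w i / a)\<^sup>2) = (ip w w - t\<^sup>2) / a\<^sup>2"
      using split by (simp add: power_divide sum_divide_distrib)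
    also have "\<dots> = (ip w w - t\<^sup>2) * (1 - 2 * \<alpha>) / (1 - \<alpha>)\<^sup>2" by (simp add: ab(3) b_def)
    also have "((t - \<alpha>) / b)\<^sup>2 + \<dots> \<le> 1"
      unfolding b_def using al t0 t1 ww by (intro half_ball_inequality) auto
    finally have zz: "z \<in> unit_ball d" using z by (simp add: unit_ball_def)
    have "D *\<^sub>v z = w + (- \<alpha>) \<cdot>\<^sub>v unit_vec d 0"
    proof (rule eq_vecI)
      fix i assume "i < dim_vec (w + (- \<alpha>) \<cdot>\<^sub>v unit_vec d 0)"
      then have i: "i < d" by simp
      have "Matrix.vec_index (D *\<^sub>v z) i
          = (\<Sum>j<d. (if i \<noteq> j then 0 else if i = 0 then b else a) * Matrix.vec_index z j)"
        using i by (simp add: D_def z_def scalar_prod_def atLeast0LessThan)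
      also have "\<dots> = (\<Sum>j<d. if j = i then (if i = 0 then b else a) * Matrix.vec_index z i else 0)"
        by (intro sum.cong) auto
      also have "\<dots> = Matrix.vec_index (w + (- \<alpha>) \<cdot>\<^sub>v unit_vec d 0) i"
        using i ab w by (simp add: z_def t_def)
      finally show "Matrix.vec_index (D *\<^sub>v z) i = Matrix.vec_index (w + (- \<alpha>) \<cdot>\<^sub>v unit_vec d 0) i" .
    qed (use D w in simp)
    then have "R *\<^sub>v (D *\<^sub>v z) = u + (- \<alpha>) \<cdot>\<^sub>v g"
      using R w Rw by (simp add: mult_add_distrib_mat_vec mult_mat_vec)
    then have "A' *\<^sub>v z = A *\<^sub>v u + (- \<alpha>) \<cdot>\<^sub>v (A *\<^sub>v g)"
      unfolding A'_def using A R D z u g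
      by (simp add: assoc_mult_mat_vec[OF A mult_carrier_mat[OF R(1) D] z] assoc_mult_mat_vec[OF R(1) D z]
          mult_add_distrib_mat_vec mult_mat_vec)
    then have "c' + A' *\<^sub>v z = \<theta>"
      unfolding c'_def u(3) using c A u g Ag by (intro eq_vecI) auto
    then show ?thesis unfolding ellipsoid_def using zz by blast
  qed
  then show ?thesis using A' detA'0 c' detA'_le by blast
qed

subsection \<open>The potential argument\<close>

text \<open>The invariant kept for each trader: the true type stays inside, and the bound on the
  inverse matrix limits how small the ellipsoid can be. The matrix is quantified existentially, as
  the set determines it only up to an orthogonal factor.\<close>

definition tracks :: "nat \<Rightarrow> real Matrix.vec set \<Rightarrow> real Matrix.vec \<Rightarrow> real \<Rightarrow> bool" where
  "tracks d E \<theta> F \<longleftrightarrow> (\<exists>A B c. A \<in> carrier_mat d d \<and> B \<in> carrier_mat d d \<and> A * B = 1\<^sub>m d \<and> B * A = 1\<^sub>m d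
     \<and> c \<in> carrier_vec d \<and> E = ellipsoid d A c \<and> \<theta> \<in> E \<and> frobenius_sq d B \<le> F)"

text \<open>This is the potential; defining it through the volume makes it independent of the matrix
  representing the set.\<close>

definition log_shrinkage :: "nat \<Rightarrow> real Matrix.vec set \<Rightarrow> real" where
  "log_shrinkage d E = - ln (enn2real (vol d E) / unit_ball_vol (real d))"

lemma log_shrinkage_ellipsoid:
  assumes "A \<in> carrier_mat d d" "Determinant.det A \<noteq> 0" "c \<in> carrier_vec d"
  shows "log_shrinkage d (ellipsoid d A c) = - ln \<bar>Determinant.det A\<bar>"
proof -
  have "unit_ball_vol (real d) \<noteq> 0" using unit_ball_vol_pos[of "real d"] by linarith
  then show ?thesis by (simp add: log_shrinkage_def vol_ellipsoid[OF assms])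
qed

lemma inverse_mat_det:
  fixes A B :: "real mat"
  assumes "A \<in> carrier_mat d d" "B \<in> carrier_mat d d" "A * B = 1\<^sub>m d"
  shows "Determinant.det A * Determinant.det B = 1"
  using Determinant.det_mult[OF assms(1,2)] assms(3) by simp

lemma unit_ball_eq_ellipsoid: "unit_ball d = ellipsoid d (1\<^sub>m d) (0\<^sub>v d)"
proof -
  have "ellipsoid d (1\<^sub>m d) (0\<^sub>v d) = (\<lambda>u. 0\<^sub>v d + 1\<^sub>m d *\<^sub>v u) ` unit_ball d"
    by (auto simp: ellipsoid_def)
  also have "\<dots> = (\<lambda>u. u) ` unit_ball d" by (rule image_cong) (auto simp: unit_ball_def)
  finally show ?thesis by simp
qed

lemma tracks_unit_ball: "\<theta> \<in> unit_ball d \<Longrightarrow> tracks d (unit_ball d) \<theta> (real d)"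
  unfolding tracks_def unit_ball_eq_ellipsoid
  by (rule exI[of _ "1\<^sub>m d"], rule exI[of _ "1\<^sub>m d"], rule exI[of _ "0\<^sub>v d"]) (auto simp: frobenius_sq_one)

lemma log_shrinkage_unit_ball: "log_shrinkage d (unit_ball d) = 0"
  unfolding unit_ball_eq_ellipsoid by (subst log_shrinkage_ellipsoid) auto

lemma tracks_mono: "tracks d E \<theta> F \<Longrightarrow> F \<le> F' \<Longrightarrow> tracks d E \<theta> F'"
  unfolding tracks_def by fastforce

lemma tracks_bounds:
  assumes "tracks d E \<theta> F" "x \<in> carrier_vec d"
  shows "lower E x \<le> ip \<theta> x" "ip \<theta> x \<le> upper E x"
proof -
  obtain A B c where A: "A \<in> carrier_mat d d" "c \<in> carrier_vec d" "E = ellipsoid d A c" "\<theta> \<in> E"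
    using assms(1) unfolding tracks_def by auto
  then show "lower E x \<le> ip \<theta> x" "ip \<theta> x \<le> upper E x"
    using ip_ellipsoid_bound[OF A(1,2) assms(2), of \<theta>]
      upper_ellipsoid[OF A(1,2) assms(2)] lower_ellipsoid[OF A(1,2) assms(2)] by auto
qed

text \<open>The potential equals the logarithm of the absolute determinant of the inverse matrix,
  which its Frobenius norm controls.\<close>

lemma log_shrinkage_le:
  assumes "tracks d E \<theta> F" "d \<ge> 1" "F \<le> F'" "0 < F'"
  shows "log_shrinkage d E \<le> real d * ln (real d * sqrt F')"
proof -
  obtain A B c where A: "A \<in> carrier_mat d d" "c \<in> carrier_vec d" "E = ellipsoid d A c"
    and B: "B \<in> carrier_mat d d" "A * B = 1\<^sub>m d" "frobenius_sq d B \<le> F"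
    using assms(1) unfolding tracks_def by auto
  have AB: "Determinant.det A * Determinant.det B = 1" by (rule inverse_mat_det[OF A(1) B(1,2)])
  then have nz: "Determinant.det A \<noteq> 0" "Determinant.det B \<noteq> 0" by auto
  have "\<bar>Determinant.det B\<bar> = 1 / \<bar>Determinant.det A\<bar>"
    using AB nz by (simp add: field_simps flip: abs_mult)
  then have "log_shrinkage d E = ln \<bar>Determinant.det B\<bar>"
    using nz by (simp add: A(3) log_shrinkage_ellipsoid[OF A(1) nz(1) A(2)] ln_div)
  also have "\<dots> \<le> ln ((real d * sqrt F') ^ d)"
  proof -
    have "\<bar>Determinant.det B\<bar> \<le> (real d * sqrt (frobenius_sq d B)) ^ d" by (rule abs_det_le_frobenius_sq[OF B(1)])
    also have "\<dots> \<le> (real d * sqrt F') ^ d"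
    proof (intro power_mono mult_left_mono)
      have "0 \<le> frobenius_sq d B" unfolding frobenius_sq_def by (intro sum_nonneg ip_nonneg)
      then show "sqrt (frobenius_sq d B) \<le> sqrt F'" "0 \<le> real d * sqrt (frobenius_sq d B)" using B(3) assms(3) by auto
    qed auto
    finally show ?thesis using nz assms(2,4) by simp
  qed
  also have "\<dots> = real d * ln (real d * sqrt F')" using assms(2,4) by (simp add: ln_realpow)
  finally show ?thesis .
qed

lemma sum_ip_unit_vec_squares:
  assumes "x \<in> carrier_vec d"
  shows "(\<Sum>i<d. (ip x (unit_vec d i))\<^sup>2) = ip x x"
  unfolding ip_self using assms by (simp add: ip_def)

text \<open>The midpoint price equals \<open>ip c x\<close>, so the cut passes through the centre.
  Summing the quadratic bound over the unit vectors, with \<open>ip x x \<le> 1\<close> and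
  \<open>ip h h > \<delta>\<^sup>2 / 4\<close>, bounds the new inverse; comparing the minimal volume
  with the explicit cover gives the potential increase.\<close>

lemma cut_step:
  assumes tr: "tracks d E \<theta> F" and d: "d \<ge> 1" and x: "x \<in> unit_ball d"
    and p: "p = (upper E x + lower E x) / 2" and wide: "upper E x - lower E x > \<delta>" and \<delta>: "\<delta> > 0"
    and \<theta>: "p \<le> ip \<theta> x" and mv: "is_min_vol_ellipsoid d (E \<inter> {\<theta>. p \<le> ip \<theta> x}) E'"
    and e: "0 < \<epsilon>"
  shows "tracks d E' \<theta> ((1 + \<epsilon>) * F + 16 * (1 + 1 / \<epsilon>) / \<delta>\<^sup>2)"
    and "log_shrinkage d E + 1 / (8 * real d) \<le> log_shrinkage d E'"
proof -
  have xc: "x \<in> carrier_vec d" "ip x x \<le> 1" using x by (auto simp: unit_ball_def)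
  obtain A B c where A: "A \<in> carrier_mat d d" and B: "B \<in> carrier_mat d d" "A * B = 1\<^sub>m d" "B * A = 1\<^sub>m d"
    and c: "c \<in> carrier_vec d" and E: "E = ellipsoid d A c" and \<theta>E: "\<theta> \<in> E" and F: "frobenius_sq d B \<le> F"
    using tr unfolding tracks_def by auto
  define h where "h = transpose_mat A *\<^sub>v x"
  have up: "upper E x = ip c x + sqrt (ip h h)" unfolding E h_def by (rule upper_ellipsoid[OF A c xc(1)])
  have lo: "lower E x = ip c x - sqrt (ip h h)" unfolding E h_def by (rule lower_ellipsoid[OF A c xc(1)])
  have pc: "p = ip c x" unfolding p up lo by simp
  have "\<delta> / 2 < sqrt (ip h h)" using wide up lo by simp
  then have "(\<delta> / 2)\<^sup>2 < (sqrt (ip h h))\<^sup>2" using \<delta> by (intro power_strict_mono) auto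
  then have hh: "\<delta>\<^sup>2 / 4 < ip h h" by (simp add: ip_nonneg power_divide)
  then have h0: "ip h h > 0" using \<delta> by (smt (verit) zero_le_power2 divide_nonneg_nonneg)
  have detA: "Determinant.det A \<noteq> 0" using inverse_mat_det[OF A B(1,2)] by auto
  obtain A' c' where A': "A' \<in> carrier_mat d d" "Determinant.det A' \<noteq> 0" and c': "c' \<in> carrier_vec d"
    and E': "E' = ellipsoid d A' c'"
    using mv unfolding is_min_vol_ellipsoid_def is_ellipsoid_def by auto
  obtain B' where B': "B' \<in> carrier_mat d d" "A' * B' = 1\<^sub>m d" "B' * A' = 1\<^sub>m d"
    using obtain_inverse_mat[OF A'] .
  have cover: "\<theta>' \<in> ellipsoid d A' c'" if "\<theta>' \<in> ellipsoid d A c" "ip c x \<le> ip \<theta>' x" for \<theta>'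
    using mv that unfolding is_min_vol_ellipsoid_def E E' pc by blast
  have "frobenius_sq d B' \<le> (\<Sum>i<d. (1 + \<epsilon>) * ip (B *\<^sub>v unit_vec d i) (B *\<^sub>v unit_vec d i)
      + 4 * (1 + 1 / \<epsilon>) * ((ip x (unit_vec d i))\<^sup>2 / ip h h))"
    unfolding frobenius_sq_def
    by (intro sum_mono half_ellipsoid_cover_quadratic_bound[OF A B A'(1) B' c c' xc(1) _ h_def h0 cover e]) auto
  also have "\<dots> = (1 + \<epsilon>) * frobenius_sq d B + 4 * (1 + 1 / \<epsilon>) * (ip x x / ip h h)"
    unfolding frobenius_sq_def sum_ip_unit_vec_squares[OF xc(1), symmetric]
    by (simp add: sum.distrib sum_distrib_left sum_divide_distrib)
  also have "\<dots> \<le> (1 + \<epsilon>) * F + 4 * (1 + 1 / \<epsilon>) * (4 / \<delta>\<^sup>2)"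
  proof (intro add_mono mult_left_mono)
    have "ip x x / ip h h \<le> 1 / (\<delta>\<^sup>2 / 4)" using xc hh h0 \<delta> by (intro frac_le) auto
    then show "ip x x / ip h h \<le> 4 / \<delta>\<^sup>2" by simp
  qed (use F e in auto)
  finally have frobenius_sq': "frobenius_sq d B' \<le> (1 + \<epsilon>) * F + 16 * (1 + 1 / \<epsilon>) / \<delta>\<^sup>2" by simp
  have "\<theta> \<in> E'" using cover \<theta>E \<theta> unfolding E E' pc by blast
  then show "tracks d E' \<theta> ((1 + \<epsilon>) * F + 16 * (1 + 1 / \<epsilon>) / \<delta>\<^sup>2)"
    unfolding tracks_def using A' B' c' E' frobenius_sq' by blast
  obtain A2 c2 where A2: "A2 \<in> carrier_mat d d" "Determinant.det A2 \<noteq> 0" and c2: "c2 \<in> carrier_vec d"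
    and sub: "{\<theta> \<in> ellipsoid d A c. ip c x \<le> ip \<theta> x} \<subseteq> ellipsoid d A2 c2"
    and det2: "\<bar>Determinant.det A2\<bar> \<le> exp (- 1 / (8 * real d)) * \<bar>Determinant.det A\<bar>"
    using half_ellipsoid_cover[OF d A detA c xc(1) h_def h0] by blast
  have "vol d E' \<le> vol d (ellipsoid d A2 c2)"
    using mv sub A2 c2 unfolding is_min_vol_ellipsoid_def is_ellipsoid_def E pc by blast
  then have "\<bar>Determinant.det A'\<bar> * unit_ball_vol (real d) \<le> \<bar>Determinant.det A2\<bar> * unit_ball_vol (real d)"
    unfolding E' vol_ellipsoid[OF A' c'] vol_ellipsoid[OF A2 c2] by (subst (asm) ennreal_le_iff) auto
  moreover have "unit_ball_vol (real d) > 0" by simp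
  ultimately have "\<bar>Determinant.det A'\<bar> \<le> \<bar>Determinant.det A2\<bar>" by simp
  also note det2
  finally have "ln \<bar>Determinant.det A'\<bar> \<le> ln (exp (- 1 / (8 * real d)) * \<bar>Determinant.det A\<bar>)"
    using A'(2) detA by (subst ln_le_cancel_iff) auto
  also have "\<dots> = - 1 / (8 * real d) + ln \<bar>Determinant.det A\<bar>" using detA by (simp add: ln_mult)
  finally show "log_shrinkage d E + 1 / (8 * real d) \<le> log_shrinkage d E'"
    unfolding E E' log_shrinkage_ellipsoid[OF A detA c] log_shrinkage_ellipsoid[OF A' c'] by simp
qed

text \<open>Negating the context exchanges \<open>upper\<close> and \<open>lower\<close> up to sign
  and turns this half-space into the one of \<open>cut_step\<close>.\<close>

lemma cut_step_le:
  assumes tr: "tracks d E \<theta> F" and d: "d \<ge> 1" and x: "x \<in> unit_ball d"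
    and p: "p = (upper E x + lower E x) / 2" and wide: "upper E x - lower E x > \<delta>" and \<delta>: "\<delta> > 0"
    and \<theta>: "ip \<theta> x \<le> p" and mv: "is_min_vol_ellipsoid d (E \<inter> {\<theta>. ip \<theta> x \<le> p}) E'"
    and e: "0 < \<epsilon>"
  shows "tracks d E' \<theta> ((1 + \<epsilon>) * F + 16 * (1 + 1 / \<epsilon>) / \<delta>\<^sup>2)"
    and "log_shrinkage d E + 1 / (8 * real d) \<le> log_shrinkage d E'"
proof -
  define x' where "x' = (-1) \<cdot>\<^sub>v x"
  have xc: "x \<in> carrier_vec d" "ip x x \<le> 1" using x by (auto simp: unit_ball_def)
  have x'c: "x' \<in> carrier_vec d" using xc by (simp add: x'_def)
  have x': "x' \<in> unit_ball d"
    using xc by (simp add: x'_def unit_ball_def ip_smult_left[of _ d] ip_smult_right[of _ d])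
  obtain A c where A: "A \<in> carrier_mat d d" and c: "c \<in> carrier_vec d" and E: "E = ellipsoid d A c" "\<theta> \<in> E"
    using tr unfolding tracks_def by auto
  have Ec: "E \<subseteq> carrier_vec d" unfolding E by (rule ellipsoid_subset_carrier[OF A c])
  have neg: "ip u x' = - ip u x" if "u \<in> carrier_vec d" for u
    using that xc by (simp add: x'_def ip_smult_right[of _ d])
  have "ip (transpose_mat A *\<^sub>v x') (transpose_mat A *\<^sub>v x') = ip (transpose_mat A *\<^sub>v x) (transpose_mat A *\<^sub>v x)"
  proof -
    have At: "transpose_mat A \<in> carrier_mat d d" using A by simp
    have "transpose_mat A *\<^sub>v x \<in> carrier_vec d" by (rule mult_mat_vec_carrier[OF At xc(1)])
    then show ?thesis
      unfolding x'_def mult_mat_vec[OF At xc(1)] by (simp add: ip_smult_left[of _ d] ip_smult_right[of _ d])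
  qed
  then have ul: "upper E x' = - lower E x" "lower E x' = - upper E x"
    unfolding E upper_ellipsoid[OF A c x'c] lower_ellipsoid[OF A c x'c]
      upper_ellipsoid[OF A c xc(1)] lower_ellipsoid[OF A c xc(1)] neg[OF c] by auto
  have "E \<inter> {\<theta>. ip \<theta> x \<le> p} = E \<inter> {\<theta>. - p \<le> ip \<theta> x'}" using Ec neg by auto
  then have mv': "is_min_vol_ellipsoid d (E \<inter> {\<theta>. - p \<le> ip \<theta> x'}) E'" using mv by simp
  have p': "- p = (upper E x' + lower E x') / 2" unfolding p ul by (simp add: field_simps)
  have wide': "upper E x' - lower E x' > \<delta>" using wide unfolding ul by simp
  have \<theta>': "- p \<le> ip \<theta> x'" using \<theta> neg[of \<theta>] Ec E by auto
  show "tracks d E' \<theta> ((1 + \<epsilon>) * F + 16 * (1 + 1 / \<epsilon>) / \<delta>\<^sup>2)"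
    and "log_shrinkage d E + 1 / (8 * real d) \<le> log_shrinkage d E'"
    using cut_step[OF tr d x' p' wide' \<delta> \<theta>' mv' e] by auto
qed

text \<open>The disjunction covers the seller rule and the buyer rule at once, whichever way each
  resolves a tie.\<close>

lemma cut_step_feedback:
  assumes "tracks d E \<theta> F" "d \<ge> 1" "x \<in> unit_ball d"
    and "p = (upper E x + lower E x) / 2" "upper E x - lower E x > \<delta>" "\<delta> > 0" "0 < \<epsilon>"
    and "is_min_vol_ellipsoid d (E \<inter> H) E'"
    and "H = {\<theta>. ip \<theta> x \<le> p} \<and> ip \<theta> x \<le> p \<or> H = {\<theta>. p \<le> ip \<theta> x} \<and> p \<le> ip \<theta> x"
  shows "tracks d E' \<theta> ((1 + \<epsilon>) * F + 16 * (1 + 1 / \<epsilon>) / \<delta>\<^sup>2)"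
    and "log_shrinkage d E + 1 / (8 * real d) \<le> log_shrinkage d E'"
  using assms(9) cut_step[OF assms(1-6) _ _ assms(7), of E'] cut_step_le[OF assms(1-6) _ _ assms(7), of E'] assms(8)
  by auto

section \<open>From a single cut to a whole run\<close>

lemma sum_update_ge:
  fixes f f' :: "nat \<Rightarrow> real"
  assumes "i < n" "\<forall>k<n. k \<noteq> i \<longrightarrow> f' k = f k" "f i + r \<le> f' i"
  shows "(\<Sum>k<n. f k) + r \<le> (\<Sum>k<n. f' k)"
proof -
  have "(\<Sum>k\<in>{..<n} - {i}. f' k) = (\<Sum>k\<in>{..<n} - {i}. f k)"
    using assms(2) by (intro sum.cong) auto
  then show ?thesis using assms(1,3) by (simp add: sum.remove[of "{..<n}" i])
qed

definition total_log_shrinkage ::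
  "nat \<Rightarrow> nat \<Rightarrow> (nat \<Rightarrow> real Matrix.vec set) \<Rightarrow> (nat \<Rightarrow> real Matrix.vec set) \<Rightarrow> real" where
  "total_log_shrinkage n d ES EB = (\<Sum>i<n. log_shrinkage d (ES i)) + (\<Sum>j<n. log_shrinkage d (EB j))"

text \<open>An exploring round gains at least \<open>1 / (8 * d)\<close>, which multiplied by
  \<open>8 * n * d\<close> pays its regret \<open>n\<close>. Otherwise the gain is 0 and the
  \<delta> term pays. The last conclusion retains the per-round bounds for the case of few
  rounds.\<close>

lemma ES_step_progress:
  fixes n d :: nat
  assumes step: "ES_step n d \<delta> thS thB x ES EB pS pB ES' EB'"
    and d: "d \<ge> 1" and x: "x \<in> unit_ball d" and \<delta>: "\<delta> > 0" and \<epsilon>: "\<epsilon> > 0"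
    and trS: "\<forall>i<n. tracks d (ES i) (thS i) F" and trB: "\<forall>j<n. tracks d (EB j) (thB j) F"
    and F: "0 \<le> F" and F': "F' = (1 + \<epsilon>) * F + 16 * (1 + 1 / \<epsilon>) / \<delta>\<^sup>2"
    and c: "\<forall>i<n. 0 \<le> ip (thS i) x" and v: "\<forall>j<n. ip (thB j) x \<le> 1"
  defines "reg \<equiv> round_regret n (\<lambda>i. ip (thS i) x) (\<lambda>j. ip (thB j) x) pS pB"
    and "gain \<equiv> total_log_shrinkage n d ES' EB' - total_log_shrinkage n d ES EB"
  shows "\<forall>i<n. tracks d (ES' i) (thS i) F'" "\<forall>j<n. tracks d (EB' j) (thB j) F'"
    and "reg \<le> 8 * real n * real d * gain + 2 * real n * \<delta>"
    and "reg \<le> real n \<or> reg \<le> 2 * real n * \<delta>"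
proof -
  have FF': "F \<le> F'"
  proof -
    have "0 \<le> \<epsilon> * F" "0 \<le> 16 * (1 + 1 / \<epsilon>) / \<delta>\<^sup>2" using F \<epsilon> by auto
    then show ?thesis unfolding F' by (simp add: algebra_simps)
  qed
  have keepS: "tracks d (ES i) (thS i) F'" and keepB: "tracks d (EB i) (thB i) F'" if "i < n" for i
    using trS trB that tracks_mono[OF _ FF'] by blast+
  have xc: "x \<in> carrier_vec d" using x by (simp add: unit_ball_def)
  have explore: "reg \<le> 8 * real n * real d * gain + 2 * real n * \<delta>"
    if "reg \<le> real n" "1 / (8 * real d) \<le> gain"
  proof -
    have "real n = 8 * real n * real d * (1 / (8 * real d))" using d by simp
    also have "\<dots> \<le> 8 * real n * real d * gain" using that(2) by (intro mult_left_mono) auto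
    finally have "real n \<le> 8 * real n * real d * gain" .
    then show ?thesis using that(1) \<delta> by (smt (verit) mult_nonneg_nonneg of_nat_0_le_iff)
  qed
  have "(\<forall>i<n. tracks d (ES' i) (thS i) F') \<and> (\<forall>j<n. tracks d (EB' j) (thB j) F')
     \<and> reg \<le> 8 * real n * real d * gain + 2 * real n * \<delta> \<and> (reg \<le> real n \<or> reg \<le> 2 * real n * \<delta>)"
    using step unfolding ES_step_def
  proof (elim disjE)
    assume "\<exists>i<n. upper (ES i) x - lower (ES i) x > \<delta> \<and>
        (let p = (upper (ES i) x + lower (ES i) x) / 2 in
          (\<forall>k<n. pS k = p) \<and> (\<forall>k<n. pB k = p) \<and>
          is_min_vol_ellipsoid d
            (ES i \<inter> (if ip (thS i) x \<le> p then {\<theta>. ip \<theta> x \<le> p} else {\<theta>. ip \<theta> x \<ge> p}))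
            (ES' i) \<and>
          (\<forall>k<n. k \<noteq> i \<longrightarrow> ES' k = ES k) \<and> (\<forall>k<n. EB' k = EB k))"
    then obtain i p where i: "i < n" and w: "upper (ES i) x - lower (ES i) x > \<delta>"
      and p: "p = (upper (ES i) x + lower (ES i) x) / 2"
      and price: "\<forall>k<n. pS k = p" "\<forall>k<n. pB k = p"
      and mv: "is_min_vol_ellipsoid d
            (ES i \<inter> (if ip (thS i) x \<le> p then {\<theta>. ip \<theta> x \<le> p} else {\<theta>. ip \<theta> x \<ge> p})) (ES' i)"
      and same: "\<forall>k<n. k \<noteq> i \<longrightarrow> ES' k = ES k" "\<forall>k<n. EB' k = EB k"
      unfolding Let_def by blast
    have tri: "tracks d (ES i) (thS i) F" using trS i by blast
    have cut: "tracks d (ES' i) (thS i) F'"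
      "log_shrinkage d (ES i) + 1 / (8 * real d) \<le> log_shrinkage d (ES' i)"
      using cut_step_feedback[OF tri d x p w \<delta> \<epsilon> mv] unfolding F' by (auto split: if_splits)
    have "(\<Sum>k<n. log_shrinkage d (ES k)) + 1 / (8 * real d) \<le> (\<Sum>k<n. log_shrinkage d (ES' k))"
      using same(1) cut(2) by (intro sum_update_ge[OF i]) auto
    then have "1 / (8 * real d) \<le> gain" using same(2) by (simp add: gain_def total_log_shrinkage_def)
    moreover have "reg \<le> real n" unfolding reg_def by (rule round_regret_single_price[OF c v price])
    moreover have "tracks d (ES' k) (thS k) F'" "tracks d (EB' k) (thB k) F'" if "k < n" for k
      using that same cut(1) keepS keepB by (cases "k = i"; simp)+
    ultimately show ?thesis using explore by blast
  next
    assume "(\<forall>i<n. \<not> upper (ES i) x - lower (ES i) x > \<delta>) \<and>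
      (\<exists>j<n. upper (EB j) x - lower (EB j) x > \<delta> \<and>
        (let q = (upper (EB j) x + lower (EB j) x) / 2 in
          (\<forall>k<n. pS k = q) \<and> (\<forall>k<n. pB k = q) \<and>
          is_min_vol_ellipsoid d
            (EB j \<inter> (if q \<le> ip (thB j) x then {\<theta>. ip \<theta> x \<ge> q} else {\<theta>. ip \<theta> x \<le> q}))
            (EB' j) \<and>
          (\<forall>k<n. k \<noteq> j \<longrightarrow> EB' k = EB k) \<and> (\<forall>k<n. ES' k = ES k)))"
    then obtain j q where j: "j < n" and w: "upper (EB j) x - lower (EB j) x > \<delta>"
      and q: "q = (upper (EB j) x + lower (EB j) x) / 2"
      and price: "\<forall>k<n. pS k = q" "\<forall>k<n. pB k = q"
      and mv: "is_min_vol_ellipsoid d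
            (EB j \<inter> (if q \<le> ip (thB j) x then {\<theta>. ip \<theta> x \<ge> q} else {\<theta>. ip \<theta> x \<le> q})) (EB' j)"
      and same: "\<forall>k<n. k \<noteq> j \<longrightarrow> EB' k = EB k" "\<forall>k<n. ES' k = ES k"
      unfolding Let_def by blast
    have trj: "tracks d (EB j) (thB j) F" using trB j by blast
    have cut: "tracks d (EB' j) (thB j) F'"
      "log_shrinkage d (EB j) + 1 / (8 * real d) \<le> log_shrinkage d (EB' j)"
      using cut_step_feedback[OF trj d x q w \<delta> \<epsilon> mv] unfolding F' by (auto split: if_splits)
    have "(\<Sum>k<n. log_shrinkage d (EB k)) + 1 / (8 * real d) \<le> (\<Sum>k<n. log_shrinkage d (EB' k))"
      using same(1) cut(2) by (intro sum_update_ge[OF j]) auto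
    then have "1 / (8 * real d) \<le> gain" using same(2) by (simp add: gain_def total_log_shrinkage_def)
    moreover have "reg \<le> real n" unfolding reg_def by (rule round_regret_single_price[OF c v price])
    moreover have "tracks d (ES' k) (thS k) F'" "tracks d (EB' k) (thB k) F'" if "k < n" for k
      using that same cut(1) keepS keepB by (cases "k = j"; simp)+
    ultimately show ?thesis using explore by blast
  next
    assume A: "(\<forall>i<n. \<not> upper (ES i) x - lower (ES i) x > \<delta>) \<and>
      (\<forall>j<n. \<not> upper (EB j) x - lower (EB j) x > \<delta>) \<and>
      (\<forall>k<n. ES' k = ES k) \<and> (\<forall>k<n. EB' k = EB k) \<and>
      (\<exists>M. is_matching n M \<and>
         gft (\<lambda>i. upper (ES i) x) (\<lambda>j. lower (EB j) x) M
           = opt_gft n (\<lambda>i. upper (ES i) x) (\<lambda>j. lower (EB j) x) \<and>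
         (\<forall>i<n. pS i = (if i \<in> fst ` M then Max ((\<lambda>i'. upper (ES i') x) ` fst ` M) else 0)) \<and>
         (\<forall>j<n. pB j = (if j \<in> snd ` M then Min ((\<lambda>j'. lower (EB j') x) ` snd ` M) else 1)))"
    then obtain M where narrow: "\<forall>i<n. upper (ES i) x - lower (ES i) x \<le> \<delta>"
        "\<forall>j<n. upper (EB j) x - lower (EB j) x \<le> \<delta>"
      and same: "\<forall>k<n. ES' k = ES k" "\<forall>k<n. EB' k = EB k"
      and M: "is_matching n M" "gft (\<lambda>i. upper (ES i) x) (\<lambda>j. lower (EB j) x) M
           = opt_gft n (\<lambda>i. upper (ES i) x) (\<lambda>j. lower (EB j) x)"
      and price: "\<forall>i<n. pS i = (if i \<in> fst ` M then Max ((\<lambda>i'. upper (ES i') x) ` fst ` M) else 0)"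
         "\<forall>j<n. pB j = (if j \<in> snd ` M then Min ((\<lambda>j'. lower (EB j') x) ` snd ` M) else 1)"
      by (auto simp: not_less)
    have S: "lower (ES i) x \<le> ip (thS i) x" "ip (thS i) x \<le> upper (ES i) x"
      and B: "lower (EB i) x \<le> ip (thB i) x" "ip (thB i) x \<le> upper (EB i) x" if "i < n" for i
      using tracks_bounds[OF _ xc] trS trB that by blast+
    have S': "\<forall>i<n. ip (thS i) x \<le> upper (ES i) x" "\<forall>i<n. upper (ES i) x \<le> ip (thS i) x + \<delta>"
      and B': "\<forall>i<n. lower (EB i) x \<le> ip (thB i) x" "\<forall>i<n. ip (thB i) x \<le> lower (EB i) x + \<delta>"
      using S B narrow by fastforce+
    have reg: "reg \<le> 2 * real n * \<delta>"
      unfolding reg_def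
      by (rule round_regret_segmented_price[OF c S' v B' M price less_imp_le[OF \<delta>]])
    moreover have "gain = 0" using same by (simp add: gain_def total_log_shrinkage_def)
    moreover have "tracks d (ES' k) (thS k) F'" "tracks d (EB' k) (thB k) F'" if "k < n" for k
      using that same keepS keepB by simp_all
    ultimately show ?thesis by simp
  qed
  then show "\<forall>i<n. tracks d (ES' i) (thS i) F'" "\<forall>j<n. tracks d (EB' j) (thB j) F'"
    "reg \<le> 8 * real n * real d * gain + 2 * real n * \<delta>" "reg \<le> real n \<or> reg \<le> 2 * real n * \<delta>"
    by blast+
qed

text \<open>The compounded factor is at most \<open>exp 1\<close>, hence at most 3, and the bracket
  is at most \<open>25 * T ^ 4\<close>; as \<open>T\<close> is at least 2, the constants fit into
  \<open>T ^ 8\<close>.\<close>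

lemma inverse_norm_growth_le:
  assumes "T \<ge> (2::nat)" "d < T"
  shows "(1 + 1 / real T) ^ T * (real d + real T * (16 * (1 + real T) * (real T)\<^sup>2)) \<le> real T ^ 12"
proof -
  let ?T = "real T"
  have T: "?T \<ge> 2" using assms by simp
  have "(1 + 1 / ?T) ^ T \<le> exp (1 / ?T) ^ T"
    by (intro power_mono exp_ge_add_one_self) simp
  also have "\<dots> = exp 1" using T by (simp flip: exp_of_nat_mult)
  also have "\<dots> \<le> 3" by (rule exp_le)
  finally have 1: "(1 + 1 / ?T) ^ T \<le> 3" .
  have le: "2 ^ k * ?T \<le> ?T ^ Suc k" for k
    using power_mono[of 2 ?T k] T by (simp add: mult_right_mono mult.commute)
  have "real d \<le> ?T" using assms by simp
  then have "8 * real d \<le> ?T ^ 4" using le[of 3] by (simp add: numeral_eq_Suc)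
  moreover have "2 * ?T ^ 3 \<le> ?T ^ 4"
    using T mult_right_mono[of 2 ?T "?T ^ 3"] by (simp add: power_Suc[symmetric] numeral_eq_Suc)
  moreover have "?T * (16 * (1 + ?T) * ?T\<^sup>2) = 16 * ?T ^ 3 + 16 * ?T ^ 4"
    by (simp add: power2_eq_square power3_eq_cube power4_eq_xxxx algebra_simps)
  moreover have "0 \<le> ?T ^ 4" by simp
  \<comment> \<open>The three contributions are at most 1/8, 8 and 16 times
    \<open>?T ^ 4\<close>.\<close>
  ultimately have 2: "real d + ?T * (16 * (1 + ?T) * ?T\<^sup>2) \<le> 25 * ?T ^ 4" by linarith
  have "(1 + 1 / ?T) ^ T * (real d + ?T * (16 * (1 + ?T) * ?T\<^sup>2)) \<le> 3 * (25 * ?T ^ 4)"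
    using 1 2 T by (intro mult_mono) auto
  also have "\<dots> \<le> 2 ^ 8 * ?T ^ 4" by simp
  also have "\<dots> \<le> ?T ^ 8 * ?T ^ 4" using T by (intro mult_right_mono power_mono) auto
  also have "\<dots> = ?T ^ 12" by (simp flip: power_add)
  finally show ?thesis .
qed

theorem theorem5p7:
  shows "\<exists>C::real. \<forall>(n::nat) (d::nat) (T::nat) thS thB x ES EB pS pB.
     n \<ge> 1 \<longrightarrow> d \<ge> 1 \<longrightarrow> T \<ge> 2 \<longrightarrow>
     (\<forall>i<n. thS i \<in> unit_ball d) \<longrightarrow> (\<forall>j<n. thB j \<in> unit_ball d) \<longrightarrow>
     (\<forall>t\<in>{1..T}. x t \<in> unit_ball d) \<longrightarrow>
     (\<forall>t\<in>{1..T}. \<forall>i<n. 0 \<le> ip (thS i) (x t) \<and> ip (thS i) (x t) \<le> 1) \<longrightarrow>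
     (\<forall>t\<in>{1..T}. \<forall>j<n. 0 \<le> ip (thB j) (x t) \<and> ip (thB j) (x t) \<le> 1) \<longrightarrow>
     ES_run n d T (1 / real T) thS thB x ES EB pS pB \<longrightarrow>
     (\<Sum>t=1..T. round_regret n (\<lambda>i. ip (thS i) (x t)) (\<lambda>j. ip (thB j) (x t)) (pS t) (pB t))
       \<le> C * real n ^ 2 * real d ^ 2 * ln (real T)"
proof (rule exI[of _ 120], intro allI impI)
  fix n d T :: nat and thS thB x ES EB pS pB
  assume n: "n \<ge> 1" and d: "d \<ge> 1" and T: "T \<ge> 2"
    and th: "\<forall>i<n. thS i \<in> unit_ball d" "\<forall>j<n. thB j \<in> unit_ball d"
    and x: "\<forall>t\<in>{1..T}. x t \<in> unit_ball d"
    and c: "\<forall>t\<in>{1..T}. \<forall>i<n. 0 \<le> ip (thS i) (x t) \<and> ip (thS i) (x t) \<le> 1"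
    and v: "\<forall>t\<in>{1..T}. \<forall>j<n. 0 \<le> ip (thB j) (x t) \<and> ip (thB j) (x t) \<le> 1"
    and run: "ES_run n d T (1 / real T) thS thB x ES EB pS pB"
  let ?reg = "\<lambda>t. round_regret n (\<lambda>i. ip (thS i) (x t)) (\<lambda>j. ip (thB j) (x t)) (pS t) (pB t)"
  \<comment> \<open>An explicit upper solution of the recursion in \<open>ES_step_progress\<close>
    with \<epsilon> and \<delta> both \<open>1 / T\<close>: every added term is charged the full
    compounded factor.\<close>
  define F where "F k = (1 + 1 / real T) ^ k * (real d + real k * (16 * (1 + real T) * (real T)\<^sup>2))" for k
  define \<Phi> where "\<Phi> t = total_log_shrinkage n d (ES t) (EB t)" for t
  have F0: "0 \<le> F k" for k by (simp add: F_def)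
  have F_step: "(1 + 1 / real T) * F k + 16 * (1 + 1 / (1 / real T)) / (1 / real T)\<^sup>2 \<le> F (Suc k)" for k
  proof -
    have "1 \<le> (1 + 1 / real T) ^ Suc k" by (rule one_le_power) simp
    then have "1 * (16 * (1 + real T) * (real T)\<^sup>2) \<le> (1 + 1 / real T) ^ Suc k * (16 * (1 + real T) * (real T)\<^sup>2)"
      by (rule mult_right_mono) simp
    then show ?thesis by (simp add: F_def power_divide algebra_simps)
  qed
  \<comment> \<open>Rounds start at 1, so \<open>Suc k\<close> indexes the ellipsoids after
    \<open>k\<close> completed rounds; \<open>k = T\<close> describes the state after the last
    one.\<close>
  have tr: "(\<forall>i<n. tracks d (ES (Suc k) i) (thS i) (F k)) \<and> (\<forall>j<n. tracks d (EB (Suc k) j) (thB j) (F k))"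
    if "k \<le> T" for k
    using that
  proof (induction k)
    case 0
    then show ?case using run th tracks_unit_ball by (simp add: ES_run_def F_def)
  next
    case (Suc k)
    then have t: "Suc k \<in> {1..T}" by simp
    then have "ES_step n d (1 / real T) thS thB (x (Suc k)) (ES (Suc k)) (EB (Suc k)) (pS (Suc k)) (pB (Suc k))
        (ES (Suc (Suc k))) (EB (Suc (Suc k)))"
      using run unfolding ES_run_def by auto
    from ES_step_progress(1,2)[OF this d _ _ _ _ _ F0[of k] refl, of "1 / real T"]
    show ?case using Suc x c v t T tracks_mono[OF _ F_step[of k]] by auto
  qed
  have progress: "?reg t \<le> 8 * real n * real d * (\<Phi> (Suc t) - \<Phi> t) + 2 * real n * (1 / real T)"
    "?reg t \<le> real n" if t: "t \<in> {1..T}" for t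
  proof -
    obtain k where k: "t = Suc k" "k \<le> T" using t by (cases t) auto
    have st: "ES_step n d (1 / real T) thS thB (x t) (ES t) (EB t) (pS t) (pB t) (ES (Suc t)) (EB (Suc t))"
      using run t unfolding ES_run_def by auto
    \<comment> \<open>Since \<open>T\<close> is at least 2, the exploitation bound is also at most
      \<open>n\<close>, so both alternatives give the trivial bound.\<close>
    have "real n * 2 \<le> real n * real T" using T by (intro mult_left_mono) auto
    then have "2 * real n * (1 / real T) \<le> real n" using T by (simp add: field_simps)
    with ES_step_progress(3,4)[OF st d _ _ _ _ _ F0[of k] refl, of "1 / real T"] tr[OF k(2)] x c v t T
    show "?reg t \<le> 8 * real n * real d * (\<Phi> (Suc t) - \<Phi> t) + 2 * real n * (1 / real T)"
      "?reg t \<le> real n"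
      unfolding \<Phi>_def k(1) by fastforce+
  qed
  \<comment> \<open>This lower bound lets terms without a logarithm be absorbed into the final
    estimate.\<close>
  have lnT: "1 / 2 \<le> ln (real T)"
  proof -
    have "1 / 2 \<le> ln (2::real)" using ln_le_minus_one[of "1 / 2 :: real"] by (simp add: ln_div)
    also have "\<dots> \<le> ln (real T)" using T by simp
    finally show ?thesis .
  qed
  have n2: "real n \<le> real n ^ 2" using n by (simp add: power2_eq_square)
  have d2: "1 \<le> real d ^ 2" using d by simp
  have nd: "real n * real d ^ 2 \<le> 2 * (real n ^ 2 * real d ^ 2 * ln (real T))"
  proof -
    have "real n * real d ^ 2 * 1 \<le> real n ^ 2 * real d ^ 2 * (2 * ln (real T))"
      using n2 lnT by (intro mult_mono) auto
    then show ?thesis by simp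
  qed
  show "(\<Sum>t=1..T. ?reg t) \<le> 120 * real n ^ 2 * real d ^ 2 * ln (real T)"
  proof (cases "T \<le> d\<^sup>2")
    case True
    have "(\<Sum>t=1..T. ?reg t) \<le> (\<Sum>t=1..T. real n)" using progress by (intro sum_mono) auto
    also have "\<dots> = real T * real n" by simp
    also have "\<dots> \<le> real (d\<^sup>2) * real n" using True by (intro mult_right_mono of_nat_mono) auto
    also have "\<dots> \<le> 2 * (real n ^ 2 * real d ^ 2 * ln (real T))" using nd by (simp add: mult.commute)
    also have "\<dots> \<le> 120 * (real n ^ 2 * real d ^ 2 * ln (real T))"
      using lnT by (intro mult_right_mono) auto
    finally show ?thesis by (simp add: mult.assoc)
  next
    case False
    have "d \<le> d\<^sup>2" using d by (simp add: power2_eq_square)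
    then have dT: "d < T" using False by simp
    have FT: "F T \<le> real T ^ 12" unfolding F_def by (rule inverse_norm_growth_le[OF T dT])
    have shrink: "log_shrinkage d E \<le> real d * (7 * ln (real T))" if "tracks d E \<theta> (F T)" for E \<theta>
    proof -
      have "log_shrinkage d E \<le> real d * ln (real d * sqrt (real T ^ 12))"
        using T by (intro log_shrinkage_le[OF that d FT]) simp
      also have "sqrt (real T ^ 12) = real T ^ 6"
        by (rule real_sqrt_unique) (simp_all flip: power_mult)
      \<comment> \<open>By \<open>d < T\<close> the dimension costs just one more power of
        \<open>T\<close>, whence the factor 7.\<close>
      also have "ln (real d * real T ^ 6) \<le> ln (real T * real T ^ 6)"
        using d dT T by (subst ln_le_cancel_iff) auto
      also have "real T * real T ^ 6 = real T ^ 7" by (simp flip: power_Suc)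
      also have "ln (real T ^ 7) = 7 * ln (real T)" using T by (simp add: ln_realpow)
      finally show ?thesis by (simp add: mult_left_mono)
    qed
    have "\<Phi> 1 = 0" using run by (simp add: \<Phi>_def total_log_shrinkage_def ES_run_def log_shrinkage_unit_ball)
    moreover have "\<Phi> (Suc T) \<le> (\<Sum>i<n. real d * (7 * ln (real T))) + (\<Sum>i<n. real d * (7 * ln (real T)))"
      unfolding \<Phi>_def total_log_shrinkage_def
      using tr[of T] shrink by (intro add_mono sum_mono) auto
    ultimately have \<Phi>: "\<Phi> (Suc T) - \<Phi> 1 \<le> 14 * (real n * real d * ln (real T))"
      by (simp add: mult_ac)
    have "(\<Sum>t=1..T. ?reg t)
        \<le> (\<Sum>t=1..T. 8 * real n * real d * (\<Phi> (Suc t) - \<Phi> t) + 2 * real n * (1 / real T))"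
      using progress by (intro sum_mono) auto
    also have "\<dots> = 8 * real n * real d * (\<Sum>t=1..T. \<Phi> (Suc t) - \<Phi> t) + 2 * real n"
      using T by (simp add: sum.distrib sum_distrib_left)
    also have "(\<Sum>t=1..T. \<Phi> (Suc t) - \<Phi> t) = \<Phi> (Suc T) - \<Phi> 1" by (rule sum_Suc_diff) simp
    also have "8 * real n * real d * (\<Phi> (Suc T) - \<Phi> 1) + 2 * real n
        \<le> 8 * real n * real d * (14 * (real n * real d * ln (real T))) + 2 * (real n * real d ^ 2)"
      using \<Phi> mult_left_mono[OF d2, of "real n"] by (intro add_mono mult_left_mono) auto
    also have "\<dots> \<le> 112 * (real n ^ 2 * real d ^ 2 * ln (real T))
        + 2 * (2 * (real n ^ 2 * real d ^ 2 * ln (real T)))"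
      using nd by (simp add: power2_eq_square mult_ac)
    \<comment> \<open>The potential contributes \<open>112 = 8 * 14\<close>, with 14 from two sides
      at 7 each; the exploitation rounds contribute 4.\<close>
    also have "\<dots> \<le> 120 * (real n ^ 2 * real d ^ 2 * ln (real T))" using lnT by simp
    finally show ?thesis by (simp add: mult.assoc)
  qed
qed

end
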